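(* Let ${\cal H}_B,{\cal H}_C$ have dimensions $d_B\le d_C$. Let $(\varphi_i,M_i)_{i=1}^N$ consist of pure states $\ket{\varphi_i}\in{\cal H}_B\otimes{\cal H}_C$ with $E(\varphi_i)\ge\log d_B-\Delta_i$ ($\Delta_i\ge0$) for all $i$, and a POVM $(M_i)_{i=1}^N$ of PPT operators with $\tr(\varphi_iM_i)\ge1-\epsilon$ for all $i$. Then for every $\gamma>1/(1-\epsilon)^2$, $$N\le\Bigl(1-\epsilon-\sqrt{1/\gamma}\Bigr)^{-1}\Bigl(\frac1N\sum_{i=1}^N2^{-\gamma(\Delta_i+1)}\Bigr)^{-1}d_C\le\Bigl(1-\epsilon-\sqrt{1/\gamma}\Bigr)^{-1}2^{\sum_{i=1}^N\gamma(\Delta_i+1)/N}\,d_C.$$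
   Context: Logarithms are base 2. $E(\varphi)=S(\tr_C\varphi)$ for pure $\varphi$. An operator $M$ on ${\cal H}_B\otimes{\cal H}_C$ is PPT if its partial transpose $M^\Gamma$ (with respect to a fixed product basis: $\ket{ij}\bra{kl}\mapsto\ket{il}\bra{kj}$) is positive semidefinite. *)

theory Defs
  imports "Jordan_Normal_Form.Char_Poly" "HOL-Computational_Algebra.Polynomial"
begin

text \<open>Conventions. H_B has dimension dB, H_C has dimension dC, and the product basis
 vector |i j> (i < dB, j < dC) of H_B (x) H_C corresponds to the index i * dC + j of
 complex vectors / matrices of dimension dB * dC.\<close>

definition pidx :: "nat \<Rightarrow> nat \<Rightarrow> nat \<Rightarrow> nat" where
  "pidx dC i j = i * dC + j"

definition unit_vec_c :: "nat \<Rightarrow> complex vec \<Rightarrow> bool" where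
  "unit_vec_c n v \<longleftrightarrow> v \<in> carrier_vec n \<and> (\<Sum>r<n. (cmod (v $ r))\<^sup>2) = 1"

definition proj :: "complex vec \<Rightarrow> complex mat" where
  "proj v = mat (dim_vec v) (dim_vec v) (\<lambda>(r, s). v $ r * cnj (v $ s))"

definition mtrace :: "complex mat \<Rightarrow> complex" where
  "mtrace A = (\<Sum>r<dim_row A. A $$ (r, r))"

definition psd :: "nat \<Rightarrow> complex mat \<Rightarrow> bool" where
  "psd n M \<longleftrightarrow> M \<in> carrier_mat n n \<and>
     (\<forall>x \<in> carrier_vec n.
        let q = (\<Sum>r<n. \<Sum>s<n. cnj (x $ r) * M $$ (r, s) * x $ s) in Im q = 0 \<and> Re q \<ge> 0)"

definition ptrace_C :: "nat \<Rightarrow> nat \<Rightarrow> complex mat \<Rightarrow> complex mat" where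
  "ptrace_C dB dC X = mat dB dB (\<lambda>(i, k). \<Sum>j<dC. X $$ (pidx dC i j, pidx dC k j))"

text \<open>Partial transpose w.r.t. the fixed product basis: |ij><kl| maps to |il><kj|.\<close>
definition ptranspose :: "nat \<Rightarrow> nat \<Rightarrow> complex mat \<Rightarrow> complex mat" where
  "ptranspose dB dC M = mat (dB * dC) (dB * dC)
     (\<lambda>(r, s). M $$ (pidx dC (r div dC) (s mod dC), pidx dC (s div dC) (r mod dC)))"

definition PPT :: "nat \<Rightarrow> nat \<Rightarrow> complex mat \<Rightarrow> bool" where
  "PPT dB dC M \<longleftrightarrow> M \<in> carrier_mat (dB * dC) (dB * dC) \<and> psd (dB * dC) (ptranspose dB dC M)"

definition xlogx :: "real \<Rightarrow> real" where
  "xlogx x = (if x \<le> 0 then 0 else x * log 2 x)"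

text \<open>Von Neumann entropy S(rho) = - sum over eigenvalues (with algebraic multiplicity,
 i.e. roots of the characteristic polynomial) of lambda log2 lambda.\<close>
definition vn_entropy :: "complex mat \<Rightarrow> real" where
  "vn_entropy \<rho> = - (\<Sum>z \<in> {z. poly (char_poly \<rho>) z = 0}.
       real (order z (char_poly \<rho>)) * xlogx (Re z))"

definition ent :: "nat \<Rightarrow> nat \<Rightarrow> complex vec \<Rightarrow> real" where
  "ent dB dC \<phi> = vn_entropy (ptrace_C dB dC (proj \<phi>))"

definition POVM :: "nat \<Rightarrow> nat \<Rightarrow> (nat \<Rightarrow> complex mat) \<Rightarrow> bool" where
  "POVM n N M \<longleftrightarrow> (\<forall>i<N. psd n (M i)) \<and>
     (\<forall>r<n. \<forall>s<n. (\<Sum>i<N. M i $$ (r, s)) = (if r = s then 1 else 0))"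

end

theory Submission
  imports Defs "Jordan_Normal_Form.Schur_Decomposition"
begin

text \<open>
  Write \<open>c = 1 / sqrt \<gamma>\<close>, \<open>T = \<gamma> (\<Delta> + 1)\<close> and let \<open>\<lambda>\<close> be the Schmidt coefficients of \<open>\<phi>\<close>. Truncating \<open>\<phi>\<close> at large
  \<open>\<lambda>\<close> loses a normalisation factor that the claimed bound does not allow, so the large coefficients are instead
  clipped: \<open>\<chi>\<close> has the coefficients \<open>min \<lambda> (\<theta> / d\<^sub>B)\<close> with \<open>\<theta> = 2^T / (3 T)\<close>.

  A PPT operator \<open>M\<close> satisfies \<open>\<langle>\<chi>|M|\<chi>\<rangle> \<le> \<theta> / d\<^sub>B * tr M\<close>, since the partial transpose of \<open>\<chi>\<close> has norm equal to
  the largest coefficient. The entropy bound and the scalar inequality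
  \<open>T (1 - sqrt (\<theta> / x))\<^sup>2 \<le> log x + 2 / (3 x)\<close> for \<open>x \<ge> \<theta>\<close>, applied to \<open>x = d\<^sub>B \<lambda>\<close>, give
  \<open>|\<phi> - \<chi>|\<^sup>2 \<le> c (1 - t)\<close> for \<open>t = 1 / (3 T)\<close>. As \<open>M \<le> 1\<close>, the weighted Cauchy-Schwarz inequality yields
  \<open>\<langle>\<phi>|M|\<phi>\<rangle> \<le> \<langle>\<chi>|M|\<chi>\<rangle> / t + |\<phi> - \<chi>|\<^sup>2 / (1 - t) \<le> 2^T / d\<^sub>B * tr M + c\<close>. Now sum over the POVM, whose traces
  add up to \<open>d\<^sub>B d\<^sub>C\<close>; the second inequality of the theorem is Jensen's.
\<close>

section \<open>The clipping inequality\<close>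

lemma powr_two_ge_linear: "2 powr (x::real) \<ge> 1 + x * ln 2"
  using exp_ge_add_one_self[of "x * ln 2"] by (simp add: powr_def)

text \<open>Convexity of \<open>2 powr f\<close>: the chord over the unit interval lies above the
  graph. The tangent at \<open>f\<close> is evaluated at 0 and at 1, and in the average with weights
  \<open>1 - f\<close> and \<open>f\<close> the slope cancels.\<close>

lemma two_powr_le_one_plus:
  fixes f :: real
  assumes "0 \<le> f" "f \<le> 1"
  shows "2 powr f \<le> 1 + f"
proof -
  let ?g = "2 powr f"
  have "?g * (1 - f * ln 2) \<le> ?g * 2 powr (- f)"
    using powr_two_ge_linear[of "- f"] by (intro mult_left_mono) auto
  also have "\<dots> = 1" by (simp flip: powr_add)
  finally have 1: "?g * (1 - f * ln 2) \<le> 1" .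
  have "?g * (1 + (1 - f) * ln 2) \<le> ?g * 2 powr (1 - f)"
    using powr_two_ge_linear[of "1 - f"] by (intro mult_left_mono) auto
  also have "\<dots> = 2" by (simp flip: powr_add)
  finally have 2: "?g * (1 + (1 - f) * ln 2) \<le> 2" .
  have "(1 - f) * (?g * (1 - f * ln 2)) + f * (?g * (1 + (1 - f) * ln 2)) \<le> (1 - f) * 1 + f * 2"
    using 1 2 assms by (intro add_mono mult_left_mono) auto
  thus ?thesis by (simp add: algebra_simps)
qed

lemma exp_one_ge: "exp (1::real) \<ge> 27 / 10"
proof -
  obtain t :: real where t: "exp 1 = (\<Sum>m<6. 1 ^ m / fact m) + exp t / fact 6 * 1 ^ 6"
    using Maclaurin_exp_le[of 1 6] by blast
  have "exp 1 = 163 / 60 + exp t / 720" using t by (simp add: eval_nat_numeral)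
  moreover have "exp t > 0" by simp
  ultimately show ?thesis by linarith
qed

lemma ln_two_ge: "ln (2::real) \<ge> 2 / 3"
proof -
  \<comment> \<open>The quadratic bound on \<open>exp\<close> is too weak at 2/3, where it gives
    more than 2, but sharp enough at 1/12.\<close>
  have "exp (2/3::real) = exp (1/12) ^ 8" by (simp flip: exp_of_nat_mult)
  also have "\<dots> \<le> (1 + 1/12 + (1/12)\<^sup>2) ^ 8" by (intro power_mono exp_bound) auto
  also have "\<dots> \<le> 2" by (simp add: eval_nat_numeral)
  finally have "ln (exp (2/3::real)) \<le> ln 2" by (subst ln_le_cancel_iff) auto
  thus ?thesis by simp
qed

text \<open>The tangent to \<open>ln\<close> at \<open>exp 1\<close> gives
  \<open>ln a \<le> a / exp 1\<close>; the slope 5/9 is 1 / (27/10 * 2/3), from the bounds on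
  \<open>exp 1\<close> and \<open>ln 2\<close>.\<close>

lemma log_two_le:
  fixes a :: real
  assumes "a > 0"
  shows "log 2 a \<le> 5 / 9 * a"
proof -
  have "27/10 * (2/3) \<le> exp 1 * ln (2::real)"
    using exp_one_ge ln_two_ge by (intro mult_mono) auto
  hence e: "9/5 \<le> exp 1 * ln (2::real)" by simp
  have "ln (a / exp 1) \<le> a / exp 1 - 1" using assms by (intro ln_le_minus_one) auto
  hence "ln a \<le> a / exp 1" using assms by (simp add: ln_div)
  hence "log 2 a \<le> a / exp 1 / ln 2" unfolding log_def by (intro divide_right_mono) auto
  also have "\<dots> = a / (exp 1 * ln 2)" by simp
  also have "\<dots> \<le> a / (9/5)" using e assms by (intro divide_left_mono) auto
  finally show ?thesis by simp
qed

lemma log_two_plus_inverse_nonneg: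
  fixes x :: real
  assumes "x > 0"
  shows "0 \<le> log 2 x + 2 / 3 / x"
proof -
  have "log 2 (1/x) \<le> 5/9 * (1/x)" using assms by (intro log_two_le) auto
  moreover have "log 2 (1/x) = - log 2 x" using assms by (simp add: log_divide)
  moreover have "5/9 * (1/x) \<le> 2/3/x" using assms by (simp add: field_simps)
  ultimately show ?thesis by linarith
qed

text \<open>\<open>p\<close> is a step function below \<open>2 * T * 2 powr (- T)\<close>. On the
  intervals [1,2], [2,3] and [3,4] it is the value of that expression at the right end, certified by
  the chord of \<open>2 powr T\<close>; beyond 4 the value 0 suffices.\<close>

lemma quadratic_gap:
  fixes T :: real
  assumes "T \<ge> 1"
  obtains p where "0 \<le> p" "p \<le> T" "p \<le> 2 * T * 2 powr (- T)" "193/100 * sqrt T \<le> T + p"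
proof -
  define S where "S = sqrt T"
  have S: "S \<ge> 0" "T = S\<^sup>2" using assms by (auto simp: S_def)
  have chord: "2 powr T \<le> 2 ^ n * (1 + T - real n)" if "real n \<le> T" "T \<le> real n + 1" for n
  proof -
    have "2 powr T = 2 powr real n * 2 powr (T - real n)" by (simp flip: powr_add)
    also have "2 powr real n = 2 ^ n" by (simp add: powr_realpow)
    also have "2 ^ n * 2 powr (T - real n) \<le> 2 ^ n * (1 + (T - real n))"
      using that by (intro mult_left_mono two_powr_le_one_plus) auto
    finally show ?thesis by (simp add: algebra_simps)
  qed
  have step: "p \<le> 2 * T * 2 powr (- T)" if "p * 2 powr T \<le> 2 * T" for p
    using that by (simp add: powr_minus field_simps)
  consider "T \<le> 2" | "2 \<le> T" "T \<le> 3" | "3 \<le> T" "T \<le> 4" | "4 \<le> T" by linarith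
  thus ?thesis
  proof cases
    case 1
    \<comment> \<open>In the first three cases the roots of the quadratic in \<open>S\<close> sum to
      193/100, and its constant term is at most the chosen \<open>p\<close>.\<close>
    have "0 \<le> (S - 193/200)\<^sup>2" by simp
    hence "193/100 * S \<le> S\<^sup>2 + 1" by (simp add: power2_eq_square field_simps)
    moreover have "1 \<le> 2 * T * 2 powr (- T)"
      using chord[of 1] 1 assms by (intro step) (simp add: algebra_simps)
    ultimately show ?thesis
      using 1 assms S by (intro that[of "1"]) (simp_all add: S_def[symmetric])
  next
    case 2
    have "(7/5)\<^sup>2 \<le> S\<^sup>2" using 2 S by (simp add: power2_eq_square)
    hence S7: "7/5 \<le> S" using S(1) by (rule power2_le_imp_le)
    have "(S - 7/5) * (S - 53/100) \<ge> 0" using S7 by (intro mult_nonneg_nonneg) auto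
    hence "193/100 * S \<le> S\<^sup>2 + 742/1000" by (simp add: power2_eq_square field_simps)
    moreover have "3/4 \<le> 2 * T * 2 powr (- T)"
      using chord[of 2] 2 assms by (intro step) (simp add: algebra_simps)
    ultimately show ?thesis
      using 2 assms S by (intro that[of "3/4"]) (simp_all add: S_def[symmetric])
  next
    case 3
    have "(17/10)\<^sup>2 \<le> S\<^sup>2" using 3 S by (simp add: power2_eq_square)
    hence S7: "17/10 \<le> S" using S(1) by (rule power2_le_imp_le)
    have "(S - 17/10) * (S - 23/100) \<ge> 0" using S7 by (intro mult_nonneg_nonneg) auto
    hence "193/100 * S \<le> S\<^sup>2 + 391/1000" by (simp add: power2_eq_square field_simps)
    moreover have "1/2 \<le> 2 * T * 2 powr (- T)"
      using chord[of 3] 3 assms by (intro step) (simp add: algebra_simps)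
    ultimately show ?thesis
      using 3 assms S by (intro that[of "1/2"]) (simp_all add: S_def[symmetric])
  next
    case 4
    have "2\<^sup>2 \<le> S\<^sup>2" using 4 S by simp
    hence S7: "2 \<le> S" using S(1) by (rule power2_le_imp_le)
    have "(S - 2) * S \<ge> 0" using S7 by (intro mult_nonneg_nonneg) auto
    hence "193/100 * S \<le> S\<^sup>2" using S7 by (simp add: power2_eq_square field_simps)
    thus ?thesis using assms S by (intro that[of 0]) (simp_all add: S_def[symmetric])
  qed
qed

text \<open>The scalar inequality for clipping, written in the clipping factor \<open>z\<close>. A
  bound linear in \<open>z\<close> is proved first and then raised to the required
  quadratic.\<close>

lemma log_two_clip_bound:
  fixes T z :: real
  assumes T: "T \<ge> 1" and z: "0 < z" "z \<le> 1"
  shows "log 2 (3 * T * z\<^sup>2) \<le> T * (2 * z - z\<^sup>2) + 2 * T * 2 powr (- T) * z\<^sup>2"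
proof -
  define S where "S = sqrt T"
  have S: "S > 0" "T = S\<^sup>2" using assms by (auto simp: S_def)
  obtain p where p: "0 \<le> p" "p \<le> T" "p \<le> 2 * T * 2 powr (- T)" "193/100 * S \<le> T + p"
    using quadratic_gap[OF T] unfolding S_def by blast
  \<comment> \<open>The constant is chosen so that 10/9 * 1737/1000 = 193/100, the slope provided by
    \<open>quadratic_gap\<close>.\<close>
  have "(sqrt 3)\<^sup>2 \<le> (1737/1000 :: real)\<^sup>2" by (simp add: power2_eq_square)
  hence s3: "sqrt 3 \<le> (1737/1000 :: real)" by (rule power2_le_imp_le) auto
  have "3 * T * z\<^sup>2 = (sqrt 3 * S * z)\<^sup>2" by (simp add: S power_mult_distrib)
  hence "log 2 (3 * T * z\<^sup>2) = 2 * log 2 (sqrt 3 * S * z)"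
    using S z by (simp add: log_nat_power)
  also have "\<dots> \<le> 2 * (5/9 * (sqrt 3 * S * z))"
    using S z by (intro mult_left_mono log_two_le) auto
  also have "\<dots> = (10/9 * sqrt 3) * S * z" by simp
  also have "\<dots> \<le> 193/100 * S * z" using s3 S z by (intro mult_right_mono) auto
  also have "\<dots> \<le> (T + p) * z" using p z by (intro mult_right_mono) auto
  \<comment> \<open>The added term is nonnegative, as \<open>z \<le> 1\<close> and
    \<open>p \<le> T\<close>, and completes the linear bound to the quadratic one.\<close>
  also have "\<dots> \<le> (T + p) * z + (1 - z) * (T - p) * z" using p z by simp
  also have "\<dots> = T * (2 * z - z\<^sup>2) + p * z\<^sup>2" by (simp add: power2_eq_square algebra_simps)
  also have "\<dots> \<le> T * (2 * z - z\<^sup>2) + 2 * T * 2 powr (- T) * z\<^sup>2"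
    using p by (intro add_left_mono mult_right_mono) auto
  finally show ?thesis .
qed

text \<open>This factor acts on amplitudes: for nonnegative \<open>\<theta>\<close>, multiplying
  \<open>x\<close> by its square gives the minimum of \<open>x\<close> and
  \<open>\<theta>\<close>.\<close>

definition clip :: "real \<Rightarrow> real \<Rightarrow> real" where
  "clip \<theta> x = (if x \<le> \<theta> then 1 else sqrt (\<theta> / x))"

lemma clip_square_le: "0 \<le> \<theta> \<Longrightarrow> x * (clip \<theta> x)\<^sup>2 \<le> \<theta>"
  by (auto simp: clip_def)

text \<open>Below the threshold the left side vanishes, and the term \<open>2 / 3 / x\<close>
  outweighs a negative logarithm. Above it, \<open>x = \<theta> / z\<^sup>2\<close> turns
  \<open>log 2 x\<close> into \<open>T - log 2 (3 * T * z\<^sup>2)\<close>, and the claim becomes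
  \<open>log_two_clip_bound\<close>.\<close>

lemma clip_defect_le:
  fixes T x :: real
  assumes T: "T \<ge> 1" and x: "x > 0"
  shows "T * (1 - clip (2 powr T / (3 * T)) x)\<^sup>2 \<le> log 2 x + 2 / 3 / x"
proof (cases "x \<le> 2 powr T / (3 * T)")
  case True
  thus ?thesis using log_two_plus_inverse_nonneg[OF x] by (simp add: clip_def)
next
  case False
  define \<theta> where "\<theta> = 2 powr T / (3 * T)"
  define z where "z = sqrt (\<theta> / x)"
  have \<theta>: "\<theta> > 0" using T by (simp add: \<theta>_def)
  have z: "0 < z" "z \<le> 1" "z\<^sup>2 = \<theta> / x" using False x \<theta> by (auto simp: z_def \<theta>_def[symmetric])
  have xz: "x = \<theta> / z\<^sup>2" using z x \<theta> by simp
  have "x = 2 powr T / (3 * T * z\<^sup>2)" unfolding xz \<theta>_def by simp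
  hence "log 2 x = T - log 2 (3 * T * z\<^sup>2)" using T z(1) by (simp add: log_divide)
  moreover have "2 / 3 / x = 2 * T * 2 powr (- T) * z\<^sup>2"
    using T by (simp add: z(3) \<theta>_def powr_minus field_simps)
  moreover have "T * (1 - z)\<^sup>2 = T - T * (2 * z - z\<^sup>2)"
    by (simp add: power2_eq_square algebra_simps)
  ultimately show ?thesis
    using log_two_clip_bound[OF T z(1,2)] False by (simp add: clip_def z_def \<theta>_def)
qed

lemma jensen_two_powr:
  fixes t :: "nat \<Rightarrow> real"
  assumes "N \<ge> 1"
  shows "2 powr (- ((\<Sum>i<N. t i) / real N)) \<le> (1 / real N) * (\<Sum>i<N. 2 powr (- t i))"
proof -
  define m where "m = (\<Sum>i<N. t i) / real N"
  \<comment> \<open>The tangent to the convex function \<open>2 powr (- t)\<close> at the mean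
    \<open>m\<close>; its linear terms cancel in the sum over \<open>i\<close>.\<close>
  have "2 powr (- m) * (1 + (m - t i) * ln 2) \<le> 2 powr (- t i)" for i
  proof -
    have "2 powr (- m) * (1 + (m - t i) * ln 2) \<le> 2 powr (- m) * 2 powr (m - t i)"
      by (intro mult_left_mono powr_two_ge_linear) auto
    thus ?thesis by (simp flip: powr_add)
  qed
  hence "(\<Sum>i<N. 2 powr (- m) * (1 + (m - t i) * ln 2)) \<le> (\<Sum>i<N. 2 powr (- t i))"
    by (intro sum_mono)
  also have "(\<Sum>i<N. 2 powr (- m) * (1 + (m - t i) * ln 2))
      = 2 powr (- m) * (real N + (real N * m - (\<Sum>i<N. t i)) * ln 2)"
    by (simp add: sum.distrib sum_subtractf flip: sum_distrib_left sum_distrib_right)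
  also have "real N * m = (\<Sum>i<N. t i)" using assms by (simp add: m_def)
  finally show ?thesis using assms by (simp add: m_def[symmetric] field_simps)
qed

section \<open>Spectral theorem and von Neumann entropy\<close>

lemma mat_adjoint_dim[simp]:
  "dim_row (mat_adjoint A) = dim_col A" "dim_col (mat_adjoint A) = dim_row A"
  by (simp_all add: mat_adjoint_def)

lemma mat_adjoint_carrier[simp]: "A \<in> carrier_mat m n \<Longrightarrow> mat_adjoint A \<in> carrier_mat n m"
  by (rule carrier_matI) auto

lemma mat_adjoint_index[simp]:
  "i < dim_col A \<Longrightarrow> j < dim_row A \<Longrightarrow> mat_adjoint A $$ (i, j) = conjugate (A $$ (j, i))"
  by (simp add: mat_adjoint_def mat_of_rows_index)

lemma mat_adjoint_adjoint[simp]: "mat_adjoint (mat_adjoint A) = A"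
  by (rule eq_matI) auto

lemma mat_adjoint_mult:
  fixes A B :: "complex mat"
  assumes "A \<in> carrier_mat m n" "B \<in> carrier_mat n k"
  shows "mat_adjoint (A * B) = mat_adjoint B * mat_adjoint A"
  by (rule eq_matI) (use assms in \<open>auto simp: scalar_prod_def intro!: sum.cong\<close>)

lemma mat_adjoint_mult_index:
  fixes U V :: "complex mat"
  assumes "U \<in> carrier_mat n m" "V \<in> carrier_mat n k" "i < m" "j < k"
  shows "(mat_adjoint U * V) $$ (i, j) = (\<Sum>r<n. cnj (U $$ (r, i)) * V $$ (r, j))"
  using assms by (auto simp: scalar_prod_def atLeast0LessThan intro!: sum.cong)

text \<open>Gram-Schmidt applied to a basis that begins with \<open>v\<close> keeps \<open>v\<close>
  as first vector; normalising the result gives the columns of \<open>W\<close>, and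
  \<open>c\<close> is the reciprocal norm of \<open>v\<close>.\<close>

lemma unitary_completion:
  fixes v :: "complex vec"
  assumes v: "v \<in> carrier_vec n" and v0: "v \<noteq> 0\<^sub>v n"
  obtains W c where "W \<in> carrier_mat n n" "mat_adjoint W * W = 1\<^sub>m n" "col W 0 = c \<cdot>\<^sub>v v"
proof -
  interpret cof_vec_space n "TYPE(complex)" .
  define b where "b = basis_completion v"
  define ws where "ws = gram_schmidt n b"
  have n: "n \<noteq> 0"
  proof
    assume "n = 0"
    with v have "v = 0\<^sub>v n" by (intro eq_vecI) auto
    with v0 show False by simp
  qed
  from basis_completion[OF v v0, folded b_def]
  have dist_b: "distinct b" and indep: "\<not> lin_dep (set b)" and b: "set b \<subseteq> carrier_vec n"
    and hdb: "hd b = v" and len_b: "length b = n" by auto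
  from hdb len_b n obtain vs where bv: "b = v # vs" by (cases b, auto)
  from gram_schmidt_result[OF b dist_b indep refl, folded ws_def]
  have ws: "set ws \<subseteq> carrier_vec n" "corthogonal ws" "length ws = n" by (auto simp: len_b)
  from gram_schmidt_hd[OF v, of vs, folded bv] have "hd ws = v" unfolding ws_def .
  hence ws0: "ws ! 0 = v" using ws(3) n by (cases ws) auto
  define N where "N j = (\<Sum>r<n. (cmod (ws ! j $ r))\<^sup>2)" for j
  have dim: "dim_vec (ws ! j) = n" if "j < n" for j
    using ws that nth_mem[of j ws] by (auto simp del: nth_mem)
  have sp: "ws ! j \<bullet>c ws ! i = (\<Sum>r<n. ws ! j $ r * cnj (ws ! i $ r))" if "i < n" "j < n" for i j
    using that by (auto simp: scalar_prod_def dim atLeast0LessThan intro!: sum.cong)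
  have N: "ws ! j \<bullet>c ws ! j = of_real (N j)" if "j < n" for j
    using sp[OF that that] by (simp add: N_def flip: complex_norm_square)
  have orth: "(ws ! j \<bullet>c ws ! i = 0) = (j \<noteq> i)" if "i < n" "j < n" for i j
    using corthogonalD[OF ws(2), of j i] that ws(3) by simp
  have Npos: "N j > 0" if "j < n" for j
  proof -
    have "N j \<noteq> 0" using orth[OF that that] N[OF that] by auto
    moreover have "N j \<ge> 0" by (auto simp: N_def intro: sum_nonneg)
    ultimately show ?thesis by simp
  qed
  define W where "W = mat n n (\<lambda>(i, j). ws ! j $ i / of_real (sqrt (N j)))"
  have W: "W \<in> carrier_mat n n" by (simp add: W_def)
  have "mat_adjoint W * W = 1\<^sub>m n"
  proof (rule eq_matI)
    fix i j assume ij: "i < dim_row (1\<^sub>m n :: complex mat)" "j < dim_col (1\<^sub>m n :: complex mat)"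
    have "(mat_adjoint W * W) $$ (i, j) = (\<Sum>r<n. cnj (W $$ (r, i)) * W $$ (r, j))"
      using ij W by (intro mat_adjoint_mult_index) auto
    also have "\<dots> = (\<Sum>r<n. ws ! j $ r * cnj (ws ! i $ r) / of_real (sqrt (N i) * sqrt (N j)))"
      using ij by (intro sum.cong) (auto simp: W_def)
    also have "\<dots> = (ws ! j \<bullet>c ws ! i) / of_real (sqrt (N i) * sqrt (N j))"
      using ij by (simp add: sp sum_divide_distrib)
    also have "\<dots> = (if i = j then 1 else 0)"
    proof (cases "i = j")
      case True
      hence "sqrt (N i) * sqrt (N j) = N j" using ij Npos[of j] by simp
      thus ?thesis using True ij N[of j] Npos[of j] by (simp del: of_real_mult)
    next
      case False
      thus ?thesis using orth[of i j] ij by simp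
    qed
    finally show "(mat_adjoint W * W) $$ (i, j) = 1\<^sub>m n $$ (i, j)" using ij by simp
  qed (use W in auto)
  moreover have "col W 0 = of_real (1 / sqrt (N 0)) \<cdot>\<^sub>v v"
    using n v by (intro eq_vecI) (auto simp: W_def ws0)
  ultimately show ?thesis using W that by blast
qed

lemma complex_eigenvector_exists:
  fixes A :: "complex mat"
  assumes A: "A \<in> carrier_mat n n" and n: "n > 0"
  obtains v e where "v \<in> carrier_vec n" "v \<noteq> 0\<^sub>v n" "A *\<^sub>v v = e \<cdot>\<^sub>v v"
proof -
  have "degree (char_poly A) \<noteq> 0" using degree_monic_char_poly[OF A] n by simp
  hence "\<not> constant (poly (char_poly A))" by (simp add: constant_degree)
  then obtain e where "poly (char_poly A) e = 0"
    using fundamental_theorem_of_algebra by blast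
  hence "eigenvalue A e" using eigenvalue_root_char_poly[OF A] by simp
  thus ?thesis using that A by (auto simp: eigenvalue_def eigenvector_def)
qed

abbreviation bordered :: "complex \<Rightarrow> complex mat \<Rightarrow> complex mat" where
  "bordered e D \<equiv> four_block_mat (mat 1 1 (\<lambda>_. e)) (0\<^sub>m 1 (dim_col D)) (0\<^sub>m (dim_row D) 1) D"

lemma bordered_mult:
  assumes "D \<in> carrier_mat n n" "D' \<in> carrier_mat n n"
  shows "bordered e D * bordered e' D' = bordered (e * e') (D * D')"
proof -
  have "bordered e D * bordered e' D' = four_block_mat
     (mat 1 1 (\<lambda>_. e) * mat 1 1 (\<lambda>_. e') + 0\<^sub>m 1 n * 0\<^sub>m n 1)
     (mat 1 1 (\<lambda>_. e) * 0\<^sub>m 1 n + 0\<^sub>m 1 n * D')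
     (0\<^sub>m n 1 * mat 1 1 (\<lambda>_. e') + D * 0\<^sub>m n 1) (0\<^sub>m n 1 * 0\<^sub>m 1 n + D * D')"
    using assms by (subst mult_four_block_mat[of _ 1 1 _ n _ n _ _ 1 _ n]) auto
  also have "mat 1 1 (\<lambda>_. e) * mat 1 1 (\<lambda>_. e') = mat 1 1 (\<lambda>_. e * e')"
    by (rule eq_matI) (auto simp: scalar_prod_def)
  also have "0\<^sub>m n 1 * 0\<^sub>m 1 n + D * D' = D * D'" using assms by simp
  finally show ?thesis using assms by (simp add: left_mult_zero_mat[where nc=1])
qed

lemma bordered_adjoint: "mat_adjoint (bordered e D) = bordered (cnj e) (mat_adjoint D)"
  by (rule eq_matI) auto

lemma bordered_one: "bordered 1 (1\<^sub>m n) = 1\<^sub>m (Suc n)"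
  by (rule eq_matI) auto

lemma bordered_diag: "bordered e (mat_diag n f) = mat_diag (Suc n) (case_nat e f)"
  by (rule eq_matI) (auto simp: mat_diag_def split: nat.split)

text \<open>Induction by deflation: an eigenvector is completed to a unitary \<open>W\<close>, and
  conjugation by \<open>W\<close> splits off its eigenvalue, leaving a Hermitian block
  \<open>D\<close> of size \<open>n\<close>.\<close>

theorem hermitian_spectral:
  fixes A :: "complex mat"
  assumes "A \<in> carrier_mat n n" "mat_adjoint A = A"
  shows "\<exists>U (lam :: nat \<Rightarrow> real). U \<in> carrier_mat n n \<and> mat_adjoint U * U = 1\<^sub>m n \<and>
           A = U * mat_diag n (\<lambda>k. of_real (lam k)) * mat_adjoint U"
  using assms
proof (induction n arbitrary: A)
  case 0
  thus ?case by (intro exI[of _ "1\<^sub>m 0"]) (auto intro!: eq_matI)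
next
  case (Suc n)
  note A = Suc.prems(1) and herm = Suc.prems(2)
  let ?C = "carrier_mat (Suc n) (Suc n) :: complex mat set"
  have closed: "X * Y \<in> ?C" if "X \<in> ?C" "Y \<in> ?C" for X Y
    using that by (rule mult_carrier_mat)
  have assoc: "X * Y * Z = X * (Y * Z)" if "X \<in> ?C" "Y \<in> ?C" "Z \<in> ?C" for X Y Z
    using that by (rule assoc_mult_mat)
  obtain v e where v: "v \<in> carrier_vec (Suc n)" "v \<noteq> 0\<^sub>v (Suc n)" "A *\<^sub>v v = e \<cdot>\<^sub>v v"
    using complex_eigenvector_exists[OF A] by blast
  obtain W c where W: "W \<in> carrier_mat (Suc n) (Suc n)" and WW: "mat_adjoint W * W = 1\<^sub>m (Suc n)"
    and col0: "col W 0 = c \<cdot>\<^sub>v v"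
    using unitary_completion[OF v(1,2)] by blast
  have W': "mat_adjoint W \<in> carrier_mat (Suc n) (Suc n)" using W by simp
  have WW': "W * mat_adjoint W = 1\<^sub>m (Suc n)"
    by (rule mat_mult_left_right_inverse[OF W' W WW])
  define B where "B = mat_adjoint W * (A * W)"
  have B: "B \<in> carrier_mat (Suc n) (Suc n)" unfolding B_def by (intro mult_carrier_mat[OF W'] mult_carrier_mat[OF A W])
  have Bherm: "mat_adjoint B = B"
  proof -
    have "mat_adjoint B = mat_adjoint (A * W) * W"
      unfolding B_def using W A W' by (subst mat_adjoint_mult[OF W', of _ "Suc n"]) auto
    also have "mat_adjoint (A * W) = mat_adjoint W * A"
      using mat_adjoint_mult[OF A W] herm by simp
    finally show ?thesis using assoc_mult_mat[OF W' A W] by (simp add: B_def)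
  qed
  have Acol: "A *\<^sub>v col W 0 = e \<cdot>\<^sub>v col W 0"
    using v A by (simp add: col0 mult_mat_vec smult_smult_assoc mult.commute)
  have B0: "B $$ (i, 0) = (if i = 0 then e else 0)" if i: "i < Suc n" for i
  proof -
    have "B $$ (i, 0) = row (mat_adjoint W) i \<bullet> col (A * W) 0"
      unfolding B_def using i W A by (intro index_mult_mat(1)) auto
    also have "col (A * W) 0 = A *\<^sub>v col W 0" by (rule col_mult2[OF A W]) simp
    also have "row (mat_adjoint W) i \<bullet> (A *\<^sub>v col W 0) = e * (row (mat_adjoint W) i \<bullet> col W 0)"
      using W W' i unfolding Acol
      by (intro scalar_prod_smult_distrib[of _ "Suc n"]) (auto intro!: carrier_vecI)
    also have "row (mat_adjoint W) i \<bullet> col W 0 = (mat_adjoint W * W) $$ (i, 0)"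
      using i W by simp
    finally show ?thesis using i by (simp add: WW)
  qed
  have Bsym: "cnj (B $$ (i, j)) = B $$ (j, i)" if "i < Suc n" "j < Suc n" for i j
    using mat_adjoint_index[of j B i] B that by (simp add: Bherm)
  have "cnj (B $$ (0, 0)) = B $$ (0, 0)" by (rule Bsym) auto
  \<comment> \<open>The eigenvalue is a diagonal entry of the Hermitian matrix \<open>B\<close>,
    hence real.\<close>
  hence e: "e = of_real (Re e)" using B0[of 0] by (simp add: complex_eq_iff)
  define D where "D = mat n n (\<lambda>(i, j). B $$ (Suc i, Suc j))"
  have D: "D \<in> carrier_mat n n" by (simp add: D_def)
  have Dherm: "mat_adjoint D = D"
    by (rule eq_matI) (auto simp: D_def Bsym)
  \<comment> \<open>Column 0 vanishes below the corner because it comes from an eigenvector; row 0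
    then vanishes by Hermitian symmetry.\<close>
  have BD: "B = bordered e D"
  proof (rule eq_matI)
    fix i j assume ij: "i < dim_row (bordered e D)" "j < dim_col (bordered e D)"
    hence "i < Suc n" "j < Suc n" by (auto simp: D_def)
    thus "B $$ (i, j) = bordered e D $$ (i, j)"
      using B0[of i] B0[of j] Bsym[of j i, symmetric] e by (cases i; cases j) (auto simp: D_def)
  qed (use B D in auto)
  obtain V lam where V: "V \<in> carrier_mat n n" and VV: "mat_adjoint V * V = 1\<^sub>m n"
    and DV: "D = V * mat_diag n (\<lambda>k. of_real (lam k)) * mat_adjoint V"
    using Suc.IH[OF D Dherm] by blast
  have V': "mat_adjoint V \<in> carrier_mat n n" using V by simp
  define F where "F = bordered 1 V"
  have F: "F \<in> carrier_mat (Suc n) (Suc n)" using V by (auto simp: F_def)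
  have F': "mat_adjoint F \<in> carrier_mat (Suc n) (Suc n)" using F by simp
  have FF: "mat_adjoint F * F = 1\<^sub>m (Suc n)"
    unfolding F_def bordered_adjoint
    using bordered_mult[OF V' V, of "cnj 1" 1] VV bordered_one[of n] by simp
  define E where "E = mat_diag (Suc n) (\<lambda>k. complex_of_real (case_nat (Re e) lam k))"
  have E: "E \<in> carrier_mat (Suc n) (Suc n)" by (simp add: E_def)
  have "E = mat_diag (Suc n) (case_nat e (\<lambda>k. of_real (lam k)))"
    unfolding E_def by (rule arg_cong[where f = "mat_diag (Suc n)"]) (use e in \<open>auto split: nat.split\<close>)
  hence Eb: "E = bordered e (mat_diag n (\<lambda>k. of_real (lam k)))" by (simp only: bordered_diag)
  have BF: "B = F * E * mat_adjoint F"
    unfolding F_def Eb bordered_adjoint bordered_mult[OF V mat_diag_dim]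
      bordered_mult[OF mult_carrier_mat[OF V mat_diag_dim] V'] BD DV by simp
  have "A = (W * mat_adjoint W) * A * (W * mat_adjoint W)"
    using A by (simp add: WW')
  also have "\<dots> = W * B * mat_adjoint W"
    unfolding B_def using A W W' by (simp add: assoc closed)
  also have "\<dots> = (W * F) * E * (mat_adjoint F * mat_adjoint W)"
    unfolding BF using F F' E W W' by (simp add: assoc closed)
  also have "mat_adjoint F * mat_adjoint W = mat_adjoint (W * F)"
    by (rule mat_adjoint_mult[OF W F, symmetric])
  finally have 1: "A = (W * F) * E * mat_adjoint (W * F)" .
  have "mat_adjoint (W * F) * (W * F) = mat_adjoint F * (mat_adjoint W * W) * F"
    unfolding mat_adjoint_mult[OF W F]
    using F F' W W' by (simp add: assoc closed)
  also have "\<dots> = 1\<^sub>m (Suc n)" unfolding WW right_mult_one_mat[OF F'] by (rule FF)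
  finally have 2: "mat_adjoint (W * F) * (W * F) = 1\<^sub>m (Suc n)" .
  have 3: "W * F \<in> carrier_mat (Suc n) (Suc n)" using W F by simp
  show ?case using 1 2 3 unfolding E_def by blast
qed

text \<open>The spectral theorem as identities between finite sums, the form used in all later
  computations. The characteristic polynomial follows by similarity to the diagonal matrix and links
  the eigenvalues to the entropy.\<close>

corollary hermitian_spectral_entries:
  fixes A :: "complex mat"
  assumes A: "A \<in> carrier_mat n n"
    and herm: "\<And>i j. i < n \<Longrightarrow> j < n \<Longrightarrow> A $$ (j, i) = cnj (A $$ (i, j))"
  obtains U :: "nat \<Rightarrow> nat \<Rightarrow> complex" and lam :: "nat \<Rightarrow> real" where
    "\<And>k l. k < n \<Longrightarrow> l < n \<Longrightarrow> (\<Sum>i<n. cnj (U i k) * U i l) = (if k = l then 1 else 0)"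
    "\<And>i j. i < n \<Longrightarrow> j < n \<Longrightarrow> (\<Sum>k<n. U i k * cnj (U j k)) = (if i = j then 1 else 0)"
    "\<And>i j. i < n \<Longrightarrow> j < n \<Longrightarrow> A $$ (i, j) = (\<Sum>k<n. of_real (lam k) * U i k * cnj (U j k))"
    "char_poly A = (\<Prod>k<n. [:- of_real (lam k), 1:])"
proof -
  have "mat_adjoint A = A"
    by (rule eq_matI) (use A in \<open>auto simp: herm[symmetric]\<close>)
  then obtain V lam where V: "V \<in> carrier_mat n n" and VV: "mat_adjoint V * V = 1\<^sub>m n"
    and AV: "A = V * mat_diag n (\<lambda>k. of_real (lam k :: real)) * mat_adjoint V"
    using hermitian_spectral[OF A] by blast
  have V': "mat_adjoint V \<in> carrier_mat n n" using V by simp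
  have VV': "V * mat_adjoint V = 1\<^sub>m n" by (rule mat_mult_left_right_inverse[OF V' V VV])
  let ?D = "mat_diag n (\<lambda>k. complex_of_real (lam k))"
  have VD: "V * ?D \<in> carrier_mat n n" using V by simp
  have mult_entry: "(X * Y) $$ (i, j) = (\<Sum>k<n. X $$ (i, k) * Y $$ (k, j))"
    if "X \<in> carrier_mat n n" "Y \<in> carrier_mat n n" "i < n" "j < n" for X Y :: "complex mat" and i j
    using that by (simp add: scalar_prod_def atLeast0LessThan)
  show ?thesis
  proof (rule that[of "\<lambda>i k. V $$ (i, k)" lam])
    show "(\<Sum>i<n. cnj (V $$ (i, k)) * V $$ (i, l)) = (if k = l then 1 else 0)" if "k < n" "l < n" for k l
      using mat_adjoint_mult_index[OF V V that] that by (simp add: VV)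
    show "(\<Sum>k<n. V $$ (i, k) * cnj (V $$ (j, k))) = (if i = j then 1 else 0)" if "i < n" "j < n" for i j
      using arg_cong[OF VV', of "\<lambda>M. M $$ (i, j)"] V that
      by (simp add: scalar_prod_def atLeast0LessThan)
    show "A $$ (i, j) = (\<Sum>k<n. of_real (lam k) * V $$ (i, k) * cnj (V $$ (j, k)))" if "i < n" "j < n" for i j
    proof -
      have "(V * ?D) $$ (i, k) = of_real (lam k) * V $$ (i, k)" if "k < n" for k
        using V \<open>i < n\<close> that by (subst mat_diag_mult_right[OF V]) (simp add: mult.commute)
      moreover have "A $$ (i, j) = (\<Sum>k<n. (V * ?D) $$ (i, k) * mat_adjoint V $$ (k, j))"
        unfolding AV using mult_entry[OF VD V' that] .
      ultimately show ?thesis using V that by simp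
    qed
    have "similar_mat_wit A ?D V (mat_adjoint V)"
      by (rule similar_mat_witI[OF VV' VV AV A _ V V']) simp
    hence "char_poly A = char_poly ?D" by (intro char_poly_similar) (auto simp: similar_mat_def)
    also have "\<dots> = (\<Prod>a\<leftarrow>diag_mat ?D. [:- a, 1:])"
      by (rule char_poly_upper_triangular[of _ n]) (auto simp: mat_diag_def upper_triangular_def)
    also have "\<dots> = (\<Prod>k\<leftarrow>[0..<n]. [:- of_real (lam k), 1:])"
      by (rule arg_cong[where f = prod_list]) (auto simp: diag_mat_def mat_diag_def intro!: nth_equalityI)
    also have "\<dots> = (\<Prod>k<n. [:- of_real (lam k), 1:])"
      by (simp add: prod.distinct_set_conv_list[symmetric] atLeast0LessThan)
    finally show "char_poly A = (\<Prod>k<n. [:- of_real (lam k), 1:])" .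
  qed
qed

section \<open>Entropy as a sum over an indexed list of eigenvalues\<close>

lemma order_prod_linear:
  fixes a :: "nat \<Rightarrow> 'a :: field"
  shows "Polynomial.order z (\<Prod>k<n. [:- a k, 1:]) = card {k. k < n \<and> a k = z}"
proof (induction n)
  case (Suc n)
  have eq: "{k. k < Suc n \<and> a k = z} =
      (if a n = z then insert n {k. k < n \<and> a k = z} else {k. k < n \<and> a k = z})"
    by (auto simp: less_Suc_eq)
  have nz: "(\<Prod>k<n. [:- a k, 1:]) * [:- a n, 1:] \<noteq> 0"
    by (simp add: prod_zero_iff del: mult_pCons_right)
  have "Polynomial.order z [:- a n, 1:] = (if a n = z then 1 else 0)"
    using order_power_n_n[of z 1] by (auto intro: order_0I)
  thus ?case using Suc nz by (simp add: order_mult[OF nz] eq del: mult_pCons_right)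
qed (simp add: order_0I)

text \<open>The multiplicity of a root is the number of indices carrying it, so grouping the indices
  by their value turns one sum into the other.\<close>

lemma sum_roots_order:
  fixes a :: "nat \<Rightarrow> 'a :: field" and f :: "'a \<Rightarrow> real" and n :: nat
  defines "p \<equiv> \<Prod>k<n. [:- a k, 1:]"
  shows "(\<Sum>z\<in>{z. poly p z = 0}. real (Polynomial.order z p) * f z) = (\<Sum>k<n. f (a k))"
proof -
  have roots: "{z. poly p z = 0} = a ` {..<n}"
    by (auto simp: p_def poly_prod prod_zero_iff)
  have "real (Polynomial.order z p) * f z = (\<Sum>k\<in>{k \<in> {..<n}. a k = z}. f (a k))" for z
    by (simp add: p_def order_prod_linear)
  hence "(\<Sum>z\<in>{z. poly p z = 0}. real (Polynomial.order z p) * f z)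
      = (\<Sum>z\<in>a ` {..<n}. \<Sum>k\<in>{k \<in> {..<n}. a k = z}. f (a k))" by (simp only: roots)
  also have "\<dots> = (\<Sum>k<n. f (a k))" by (rule sum.image_gen[symmetric]) simp
  finally show ?thesis .
qed

lemma vn_entropy_eq_sum:
  fixes lam :: "nat \<Rightarrow> real"
  assumes "char_poly A = (\<Prod>k<n. [:- of_real (lam k), 1:])"
  shows "vn_entropy A = - (\<Sum>k<n. xlogx (lam k))"
  unfolding vn_entropy_def assms
  using sum_roots_order[of "\<lambda>k. complex_of_real (lam k)" n "\<lambda>z. xlogx (Re z)"] by simp

section \<open>Positive forms and partial transposition\<close>

lemma sum_pidx:
  "(\<Sum>r<a * b. f r) = (\<Sum>i<a. \<Sum>j<b. f (pidx b i j))"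
proof -
  have "sum f {i * b..<i * b + b} = (\<Sum>j<b. f (pidx b i j))" for i
    using sum.shift_bounds_nat_ivl[of f 0 "i * b" b]
    by (simp add: pidx_def add.commute atLeast0LessThan)
  thus ?thesis using sum.nat_group[of f b a] by simp
qed

lemma pidx_div_mod[simp]:
  "j < b \<Longrightarrow> pidx b i j div b = i" "j < b \<Longrightarrow> pidx b i j mod b = j"
  by (auto simp: pidx_def)

lemma pidx_less:
  assumes "i < a" "j < b"
  shows "pidx b i j < a * b"
proof -
  have "pidx b i j < Suc i * b" using assms by (simp add: pidx_def)
  also have "\<dots> \<le> a * b" using assms by (intro mult_le_mono1) simp
  finally show ?thesis .
qed

text \<open>The arguments are functions instead of vectors, so that sums and product vectors carry
  no dimension conditions.\<close>

definition sform :: "nat \<Rightarrow> complex mat \<Rightarrow> (nat \<Rightarrow> complex) \<Rightarrow> (nat \<Rightarrow> complex) \<Rightarrow> complex" where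
  "sform n M x y = (\<Sum>r<n. \<Sum>s<n. cnj (x r) * M $$ (r, s) * y s)"

lemma sform_cong:
  assumes "\<And>r. r < n \<Longrightarrow> x r = x' r" "\<And>r. r < n \<Longrightarrow> y r = y' r"
  shows "sform n M x y = sform n M x' y'"
  unfolding sform_def using assms by (intro sum.cong) auto

lemma psd_sform_nonneg:
  assumes "psd n M"
  shows "0 \<le> Re (sform n M x x)"
proof -
  have "sform n M x x = (\<Sum>r<n. \<Sum>s<n. cnj (vec n x $ r) * M $$ (r, s) * vec n x $ s)"
    unfolding sform_def by (intro sum.cong) auto
  moreover have "0 \<le> Re (\<Sum>r<n. \<Sum>s<n. cnj (vec n x $ r) * M $$ (r, s) * vec n x $ s)"
    using assms vec_carrier[of n x] unfolding psd_def Let_def by blast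
  ultimately show ?thesis by (simp only:)
qed

lemma sform_real_combination:
  fixes \<alpha> \<beta> :: real
  shows "sform n M (\<lambda>r. of_real \<alpha> * x r + of_real \<beta> * y r) (\<lambda>r. of_real \<alpha> * x r + of_real \<beta> * y r)
     = of_real (\<alpha>\<^sup>2) * sform n M x x
     + of_real (\<alpha> * \<beta>) * (sform n M x y + sform n M y x) + of_real (\<beta>\<^sup>2) * sform n M y y"
  unfolding sform_def sum_distrib_left sum.distrib[symmetric]
  by (intro sum.cong refl) (simp add: algebra_simps power2_eq_square)

lemma psd_sform_cross_le:
  assumes "psd n M"
  shows "Re (sform n M x y) + Re (sform n M y x) \<le> Re (sform n M x x) + Re (sform n M y y)"
  using psd_sform_nonneg[OF assms, of "\<lambda>r. of_real 1 * x r + of_real (-1) * y r"]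
  unfolding sform_real_combination by simp

text \<open>Positivity at \<open>\<alpha> x - y / \<alpha>\<close> bounds the cross terms by
  \<open>\<alpha>\<^sup>2\<close> times the form at \<open>x\<close> plus the form at
  \<open>y\<close> divided by \<open>\<alpha>\<^sup>2\<close>. With
  \<open>\<alpha>\<^sup>2 = (1 - t) / t\<close> the total factors are \<open>1 / t\<close> and
  \<open>1 / (1 - t)\<close>.\<close>

lemma psd_sform_add_le:
  assumes "psd n M" and t: "0 < t" "t < 1"
  shows "Re (sform n M (\<lambda>r. x r + y r) (\<lambda>r. x r + y r))
           \<le> Re (sform n M x x) / t + Re (sform n M y y) / (1 - t)"
proof -
  define \<alpha> where "\<alpha> = sqrt ((1 - t) / t)"
  have \<alpha>: "\<alpha> > 0" "\<alpha>\<^sup>2 = (1 - t) / t" using t by (auto simp: \<alpha>_def)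
  let ?c = "Re (sform n M x y) + Re (sform n M y x)"
  have "0 \<le> Re (sform n M (\<lambda>r. of_real \<alpha> * x r + of_real (- (1 / \<alpha>)) * y r)
      (\<lambda>r. of_real \<alpha> * x r + of_real (- (1 / \<alpha>)) * y r))"
    by (rule psd_sform_nonneg[OF assms(1)])
  also have "\<dots> = \<alpha>\<^sup>2 * Re (sform n M x x) - ?c + (1 / \<alpha>\<^sup>2) * Re (sform n M y y)"
    unfolding sform_real_combination using \<alpha>(1) by (simp add: power_divide flip: of_real_power)
  finally have "?c \<le> (1 - t) / t * Re (sform n M x x) + t / (1 - t) * Re (sform n M y y)"
    using t by (simp add: \<alpha>(2))
  moreover have "Re (sform n M (\<lambda>r. x r + y r) (\<lambda>r. x r + y r))
      = Re (sform n M x x) + ?c + Re (sform n M y y)"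
    using sform_real_combination[of n M 1 x 1 y] by simp
  moreover have "Re (sform n M x x) / t = Re (sform n M x x) + (1 - t) / t * Re (sform n M x x)"
    using t by (simp add: field_simps)
  moreover have "Re (sform n M y y) / (1 - t) = Re (sform n M y y) + t / (1 - t) * Re (sform n M y y)"
    using t by (simp add: field_simps)
  ultimately show ?thesis by linarith
qed

lemma cnj_mult_self: "cnj z * z = of_real ((cmod z)\<^sup>2)"
  by (metis complex_norm_square mult.commute)

text \<open>The forms of all POVM elements are nonnegative and add up to the squared norm, so each
  of them is at most the squared norm.\<close>

lemma POVM_sform_le:
  assumes "POVM n N M" "i < N"
  shows "Re (sform n (M i) x x) \<le> (\<Sum>r<n. (cmod (x r))\<^sup>2)"
proof -
  have psd: "psd n (M j)" if "j < N" for j using assms that by (auto simp: POVM_def)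
  have "Re (sform n (M i) x x) \<le> (\<Sum>j<N. Re (sform n (M j) x x))"
    using assms psd by (intro member_le_sum) (auto intro: psd_sform_nonneg)
  also have "\<dots> = Re (\<Sum>j<N. sform n (M j) x x)" by simp
  also have "(\<Sum>j<N. sform n (M j) x x)
      = (\<Sum>r<n. \<Sum>s<n. cnj (x r) * (\<Sum>j<N. M j $$ (r, s)) * x s)"
  proof -
    have "(\<Sum>j<N. sform n (M j) x x) = (\<Sum>r<n. \<Sum>j<N. \<Sum>s<n. cnj (x r) * M j $$ (r, s) * x s)"
      unfolding sform_def by (rule sum.swap)
    also have "\<dots> = (\<Sum>r<n. \<Sum>s<n. \<Sum>j<N. cnj (x r) * M j $$ (r, s) * x s)"
      by (intro sum.cong refl sum.swap)
    finally show ?thesis by (simp add: sum_distrib_left sum_distrib_right)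
  qed
  also have "\<dots> = (\<Sum>r<n. \<Sum>s<n. if s = r then cnj (x r) * x s else 0)"
    using assms unfolding POVM_def by (intro sum.cong) auto
  also have "\<dots> = (\<Sum>r<n. cnj (x r) * x r)" by simp
  also have "\<dots> = (\<Sum>r<n. of_real ((cmod (x r))\<^sup>2))"
    by (simp only: cnj_mult_self)
  also have "Re \<dots> = (\<Sum>r<n. (cmod (x r))\<^sup>2)" by simp
  finally show ?thesis .
qed

lemma mtrace_proj_mult:
  assumes "v \<in> carrier_vec n" "M \<in> carrier_mat n n"
  shows "mtrace (proj v * M) = sform n M (\<lambda>r. v $ r) (\<lambda>r. v $ r)"
proof -
  have "mtrace (proj v * M) = (\<Sum>r<n. \<Sum>s<n. v $ r * cnj (v $ s) * M $$ (s, r))"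
    using assms by (auto simp: mtrace_def proj_def scalar_prod_def atLeast0LessThan intro!: sum.cong)
  also have "\<dots> = (\<Sum>s<n. \<Sum>r<n. v $ r * cnj (v $ s) * M $$ (s, r))" by (rule sum.swap)
  finally show ?thesis by (simp add: sform_def mult_ac)
qed

text \<open>A coefficient matrix read as a vector of the product space, inverse to the numbering
  \<open>pidx\<close>.\<close>

definition vectorize :: "nat \<Rightarrow> (nat \<Rightarrow> nat \<Rightarrow> complex) \<Rightarrow> nat \<Rightarrow> complex" where
  "vectorize b K r = K (r div b) (r mod b)"

lemma vectorize_pidx[simp]: "j < b \<Longrightarrow> vectorize b K (pidx b i j) = K i j"
  by (simp add: vectorize_def)

lemma sform_vectorize:
  "sform (a * b) M (vectorize b K) (vectorize b L)
     = (\<Sum>k<a. \<Sum>l<b. \<Sum>i<a. \<Sum>j<b. cnj (K k l) * M $$ (pidx b k l, pidx b i j) * L i j)"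
  unfolding sform_def sum_pidx by (intro sum.cong) auto

text \<open>The arguments are the product vectors \<open>x\<close> tensor the basis vector
  \<open>l\<close> and \<open>y\<close> tensor the basis vector \<open>j\<close>, so only one block
  of \<open>M\<close> survives.\<close>

lemma sform_vectorize_slices:
  assumes "l < b" "j < b"
  shows "sform (a * b) M (vectorize b (\<lambda>k l'. if l' = l then x k else 0))
            (vectorize b (\<lambda>i j'. if j' = j then y i else 0))
     = (\<Sum>k<a. \<Sum>i<a. cnj (x k) * M $$ (pidx b k l, pidx b i j) * y i)"
  unfolding sform_vectorize
proof (rule sum.cong[OF refl])
  fix k
  have "(\<Sum>i<a. \<Sum>j'<b. cnj (if l' = l then x k else 0) * M $$ (pidx b k l', pidx b i j')
          * (if j' = j then y i else 0))
      = (if l' = l then \<Sum>i<a. cnj (x k) * M $$ (pidx b k l, pidx b i j) * y i else 0)" for l'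
    using assms by (auto simp: if_distrib[of "\<lambda>z. _ * z"] cong: if_cong)
  thus "(\<Sum>l'<b. \<Sum>i<a. \<Sum>j'<b. cnj (if l' = l then x k else 0) * M $$ (pidx b k l', pidx b i j')
          * (if j' = j then y i else 0))
      = (\<Sum>i<a. cnj (x k) * M $$ (pidx b k l, pidx b i j) * y i)"
    using assms by simp
qed

lemma ptranspose_index:
  assumes "k < a" "j < b" "i < a" "l < b"
  shows "ptranspose a b M $$ (pidx b k j, pidx b i l) = M $$ (pidx b k l, pidx b i j)"
  using assms by (simp add: ptranspose_def pidx_less)

text \<open>Let \<open>x l j\<close> be column \<open>j\<close> of \<open>K\<close> tensored with the basis vector \<open>l\<close>. The form of \<open>M\<close> at \<open>K\<close> is the sum over
  \<open>l, j\<close> of the partially transposed form at the pair \<open>x j l\<close>, \<open>x l j\<close>; positivity of the latter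
  form bounds the off-diagonal terms by the diagonal ones.\<close>

lemma PPT_sform_le:
  assumes "PPT a b M"
  shows "Re (sform (a * b) M (vectorize b K) (vectorize b K))
     \<le> Re (\<Sum>k<a. \<Sum>i<a. (\<Sum>j<b. cnj (K k j) * K i j) * (\<Sum>l<b. M $$ (pidx b k l, pidx b i l)))"
proof -
  let ?Q = "ptranspose a b M"
  have psd: "psd (a * b) ?Q" using assms by (simp add: PPT_def)
  define x where "x l j = vectorize b (\<lambda>i l'. if l' = l then K i j else 0)" for l j
  have pair: "sform (a * b) ?Q (x l' j') (x l j)
      = (\<Sum>k<a. \<Sum>i<a. cnj (K k j') * M $$ (pidx b k l, pidx b i l') * K i j)"
    if "l < b" "l' < b" for l l' j j'
    unfolding x_def sform_vectorize_slices[OF that(2,1)]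
    by (intro sum.cong refl) (simp add: ptranspose_index that)
  define f where "f l j = Re (sform (a * b) ?Q (x j l) (x l j))" for l j
  define g where "g l j = Re (sform (a * b) ?Q (x l j) (x l j))" for l j
  have fg: "f l j + f j l \<le> g l j + g j l" for l j
    unfolding f_def g_def using psd_sform_cross_le[OF psd, of "x j l" "x l j"] by simp
  have "(\<Sum>l<b. \<Sum>j<b. f l j) + (\<Sum>l<b. \<Sum>j<b. f j l) \<le> (\<Sum>l<b. \<Sum>j<b. g l j) + (\<Sum>l<b. \<Sum>j<b. g j l)"
    unfolding sum.distrib[symmetric] by (intro sum_mono fg)
  moreover have "(\<Sum>l<b. \<Sum>j<b. f j l) = (\<Sum>l<b. \<Sum>j<b. f l j)" by (rule sum.swap)
  moreover have "(\<Sum>l<b. \<Sum>j<b. g j l) = (\<Sum>l<b. \<Sum>j<b. g l j)" by (rule sum.swap)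
  ultimately have le: "(\<Sum>l<b. \<Sum>j<b. f l j) \<le> (\<Sum>l<b. \<Sum>j<b. g l j)" by linarith
  have "sform (a * b) M (vectorize b K) (vectorize b K)
      = (\<Sum>l<b. \<Sum>k<a. \<Sum>i<a. \<Sum>j<b. cnj (K k l) * M $$ (pidx b k l, pidx b i j) * K i j)"
    unfolding sform_vectorize by (rule sum.swap)
  also have "\<dots> = (\<Sum>l<b. \<Sum>k<a. \<Sum>j<b. \<Sum>i<a. cnj (K k l) * M $$ (pidx b k l, pidx b i j) * K i j)"
    by (intro sum.cong refl sum.swap)
  also have "\<dots> = (\<Sum>l<b. \<Sum>j<b. \<Sum>k<a. \<Sum>i<a. cnj (K k l) * M $$ (pidx b k l, pidx b i j) * K i j)"
    by (intro sum.cong refl sum.swap)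
  also have "\<dots> = (\<Sum>l<b. \<Sum>j<b. sform (a * b) ?Q (x j l) (x l j))"
    by (intro sum.cong refl pair[symmetric]) auto
  finally have 1: "Re (sform (a * b) M (vectorize b K) (vectorize b K)) = (\<Sum>l<b. \<Sum>j<b. f l j)"
    by (simp only: f_def Re_sum)
  \<comment> \<open>This quantity is the trace of \<open>K\<close> times its adjoint against the
    partial trace of \<open>M\<close> over the second factor; it collects the diagonal terms
    \<open>g\<close>.\<close>
  have "(\<Sum>k<a. \<Sum>i<a. (\<Sum>j<b. cnj (K k j) * K i j) * (\<Sum>l<b. M $$ (pidx b k l, pidx b i l)))
      = (\<Sum>k<a. \<Sum>i<a. \<Sum>l<b. \<Sum>j<b. cnj (K k j) * M $$ (pidx b k l, pidx b i l) * K i j)"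
    by (simp add: sum_distrib_left sum_distrib_right mult_ac)
  also have "\<dots> = (\<Sum>k<a. \<Sum>l<b. \<Sum>i<a. \<Sum>j<b. cnj (K k j) * M $$ (pidx b k l, pidx b i l) * K i j)"
    by (intro sum.cong refl sum.swap)
  also have "\<dots> = (\<Sum>k<a. \<Sum>l<b. \<Sum>j<b. \<Sum>i<a. cnj (K k j) * M $$ (pidx b k l, pidx b i l) * K i j)"
    by (intro sum.cong refl sum.swap)
  also have "\<dots> = (\<Sum>l<b. \<Sum>k<a. \<Sum>j<b. \<Sum>i<a. cnj (K k j) * M $$ (pidx b k l, pidx b i l) * K i j)"
    by (rule sum.swap)
  also have "\<dots> = (\<Sum>l<b. \<Sum>j<b. \<Sum>k<a. \<Sum>i<a. cnj (K k j) * M $$ (pidx b k l, pidx b i l) * K i j)"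
    by (intro sum.cong refl sum.swap)
  also have "\<dots> = (\<Sum>l<b. \<Sum>j<b. sform (a * b) ?Q (x l j) (x l j))"
    by (intro sum.cong refl pair[symmetric]) auto
  finally have 2: "Re (\<Sum>k<a. \<Sum>i<a. (\<Sum>j<b. cnj (K k j) * K i j) * (\<Sum>l<b. M $$ (pidx b k l, pidx b i l)))
      = (\<Sum>l<b. \<Sum>j<b. g l j)" by (simp only: g_def Re_sum)
  show ?thesis using le unfolding 1 2 .
qed

section \<open>Schmidt decomposition and the overlap bound\<close>

lemma isometry_inner:
  fixes U :: "nat \<Rightarrow> nat \<Rightarrow> complex"
  assumes orth: "\<And>k l. k < n \<Longrightarrow> l < n \<Longrightarrow> (\<Sum>i<n. cnj (U i k) * U i l) = (if k = l then 1 else 0)"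
  shows "(\<Sum>i<n. cnj (\<Sum>k<n. U i k * a k) * (\<Sum>l<n. U i l * b l)) = (\<Sum>k<n. cnj (a k) * b k)"
proof -
  have "(\<Sum>i<n. cnj (\<Sum>k<n. U i k * a k) * (\<Sum>l<n. U i l * b l))
      = (\<Sum>i<n. \<Sum>k<n. \<Sum>l<n. cnj (a k) * b l * (cnj (U i k) * U i l))"
    unfolding cnj_sum sum_product by (simp add: mult_ac)
  also have "\<dots> = (\<Sum>k<n. \<Sum>i<n. \<Sum>l<n. cnj (a k) * b l * (cnj (U i k) * U i l))"
    by (rule sum.swap)
  also have "\<dots> = (\<Sum>k<n. \<Sum>l<n. \<Sum>i<n. cnj (a k) * b l * (cnj (U i k) * U i l))"
    by (intro sum.cong refl sum.swap)
  also have "\<dots> = (\<Sum>k<n. \<Sum>l<n. cnj (a k) * b l * (if k = l then 1 else 0))"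
    by (intro sum.cong refl) (simp add: orth flip: sum_distrib_left)
  also have "\<dots> = (\<Sum>k<n. \<Sum>l<n. if k = l then cnj (a k) * b l else 0)"
    by (intro sum.cong refl) auto
  finally show ?thesis by simp
qed

lemma isometry_norm:
  fixes U :: "nat \<Rightarrow> nat \<Rightarrow> complex"
  assumes "\<And>k l. k < n \<Longrightarrow> l < n \<Longrightarrow> (\<Sum>i<n. cnj (U i k) * U i l) = (if k = l then 1 else 0)"
  shows "(\<Sum>i<n. (cmod (\<Sum>k<n. U i k * a k))\<^sup>2) = (\<Sum>k<n. (cmod (a k))\<^sup>2)"
proof -
  have "(\<Sum>i<n. of_real ((cmod (\<Sum>k<n. U i k * a k))\<^sup>2)) = (\<Sum>k<n. complex_of_real ((cmod (a k))\<^sup>2))"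
    using isometry_inner[OF assms, of a a] unfolding cnj_mult_self .
  thus ?thesis unfolding of_real_sum[symmetric] of_real_eq_iff .
qed

text \<open>The columns of \<open>U\<close> are eigenvectors of the reduced state and
  \<open>\<Psi> m\<close> is the partial inner product of column \<open>m\<close> with
  \<open>\<phi>\<close>. The \<open>\<Psi> m\<close> stay unnormalised, with squared norms
  \<open>lam m\<close>, so zero eigenvalues cause no division.\<close>

lemma schmidt_decomposition:
  assumes \<phi>: "unit_vec_c (dB * dC) \<phi>"
  obtains U \<Psi> :: "nat \<Rightarrow> nat \<Rightarrow> complex" and lam :: "nat \<Rightarrow> real" where
    "\<And>k l. k < dB \<Longrightarrow> l < dB \<Longrightarrow> (\<Sum>i<dB. cnj (U i k) * U i l) = (if k = l then 1 else 0)"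
    "\<And>i j. i < dB \<Longrightarrow> j < dB \<Longrightarrow> (\<Sum>k<dB. U i k * cnj (U j k)) = (if i = j then 1 else 0)"
    "\<And>i j. i < dB \<Longrightarrow> j < dC \<Longrightarrow> \<phi> $ pidx dC i j = (\<Sum>m<dB. U i m * \<Psi> m j)"
    "\<And>m m'. m < dB \<Longrightarrow> m' < dB \<Longrightarrow> (\<Sum>j<dC. cnj (\<Psi> m j) * \<Psi> m' j) = (if m = m' then of_real (lam m) else 0)"
    "\<And>m. m < dB \<Longrightarrow> 0 \<le> lam m" "(\<Sum>m<dB. lam m) = 1"
    "ent dB dC \<phi> = - (\<Sum>m<dB. xlogx (lam m))"
proof -
  define \<Phi> where "\<Phi> i j = \<phi> $ pidx dC i j" for i j
  have dim: "dim_vec \<phi> = dB * dC" and norm: "(\<Sum>i<dB. \<Sum>j<dC. (cmod (\<Phi> i j))\<^sup>2) = 1"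
    using \<phi> by (auto simp: unit_vec_c_def sum_pidx \<Phi>_def)
  define \<rho> where "\<rho> = ptrace_C dB dC (proj \<phi>)"
  have \<rho>: "\<rho> \<in> carrier_mat dB dB" by (simp add: \<rho>_def ptrace_C_def)
  have \<rho>_entry: "\<rho> $$ (i, k) = (\<Sum>j<dC. \<Phi> i j * cnj (\<Phi> k j))" if "i < dB" "k < dB" for i k
    using that by (auto simp: \<rho>_def ptrace_C_def proj_def dim pidx_less \<Phi>_def intro!: sum.cong)
  have herm: "\<rho> $$ (k, i) = cnj (\<rho> $$ (i, k))" if "i < dB" "k < dB" for i k
    using that by (simp add: \<rho>_entry mult.commute)
  obtain U lam where orth: "\<And>k l. k < dB \<Longrightarrow> l < dB \<Longrightarrow> (\<Sum>i<dB. cnj (U i k) * U i l) = (if k = l then 1 else 0)"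
    and comp: "\<And>i j. i < dB \<Longrightarrow> j < dB \<Longrightarrow> (\<Sum>k<dB. U i k * cnj (U j k)) = (if i = j then 1 else 0)"
    and spec: "\<And>i j. i < dB \<Longrightarrow> j < dB \<Longrightarrow> \<rho> $$ (i, j) = (\<Sum>k<dB. of_real (lam k :: real) * U i k * cnj (U j k))"
    and char: "char_poly \<rho> = (\<Prod>k<dB. [:- of_real (lam k), 1:])"
    using hermitian_spectral_entries[OF \<rho> herm] by blast
  define \<Psi> where "\<Psi> m j = (\<Sum>i<dB. cnj (U i m) * \<Phi> i j)" for m j
  have exp: "\<Phi> i j = (\<Sum>m<dB. U i m * \<Psi> m j)" if "i < dB" "j < dC" for i j
  proof -
    have "(\<Sum>m<dB. U i m * \<Psi> m j) = (\<Sum>m<dB. \<Sum>i'<dB. \<Phi> i' j * (U i m * cnj (U i' m)))"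
      by (simp add: \<Psi>_def sum_distrib_left mult_ac)
    also have "\<dots> = (\<Sum>i'<dB. \<Sum>m<dB. \<Phi> i' j * (U i m * cnj (U i' m)))" by (rule sum.swap)
    also have "\<dots> = (\<Sum>i'<dB. \<Phi> i' j * (if i = i' then 1 else 0))"
      using that by (intro sum.cong refl) (simp add: comp flip: sum_distrib_left)
    also have "\<dots> = (\<Sum>i'<dB. if i = i' then \<Phi> i' j else 0)" by (intro sum.cong refl) auto
    also have "\<dots> = \<Phi> i j" using that by simp
    finally show ?thesis ..
  qed
  \<comment> \<open>Up to transposition, the Gram matrix of the \<open>\<Psi> m\<close> is the
    reduced state in its own eigenbasis, hence diagonal.\<close>
  have gram: "(\<Sum>j<dC. cnj (\<Psi> m j) * \<Psi> m' j) = (if m = m' then of_real (lam m) else 0)"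
    if m: "m < dB" "m' < dB" for m m'
  proof -
    have "(\<Sum>j<dC. cnj (\<Psi> m j) * \<Psi> m' j)
        = (\<Sum>j<dC. \<Sum>i<dB. \<Sum>i'<dB. cnj (U i' m') * U i m * (\<Phi> i' j * cnj (\<Phi> i j)))"
      unfolding \<Psi>_def cnj_sum sum_product by (simp add: mult_ac)
    also have "\<dots> = (\<Sum>i<dB. \<Sum>j<dC. \<Sum>i'<dB. cnj (U i' m') * U i m * (\<Phi> i' j * cnj (\<Phi> i j)))"
      by (rule sum.swap)
    also have "\<dots> = (\<Sum>i<dB. \<Sum>i'<dB. \<Sum>j<dC. cnj (U i' m') * U i m * (\<Phi> i' j * cnj (\<Phi> i j)))"
      by (intro sum.cong refl sum.swap)
    also have "\<dots> = (\<Sum>i<dB. \<Sum>i'<dB. cnj (U i' m') * U i m * \<rho> $$ (i', i))"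
      by (intro sum.cong refl) (simp add: \<rho>_entry flip: sum_distrib_left)
    also have "\<dots> = (\<Sum>i<dB. \<Sum>i'<dB. \<Sum>k<dB. of_real (lam k) * (cnj (U i k) * U i m) * (cnj (U i' m') * U i' k))"
      by (intro sum.cong refl) (simp add: spec sum_distrib_left mult_ac)
    also have "\<dots> = (\<Sum>i<dB. \<Sum>k<dB. \<Sum>i'<dB. of_real (lam k) * (cnj (U i k) * U i m) * (cnj (U i' m') * U i' k))"
      by (intro sum.cong refl sum.swap)
    also have "\<dots> = (\<Sum>k<dB. \<Sum>i<dB. \<Sum>i'<dB. of_real (lam k) * (cnj (U i k) * U i m) * (cnj (U i' m') * U i' k))"
      by (rule sum.swap)
    also have "\<dots> = (\<Sum>k<dB. of_real (lam k) * ((\<Sum>i<dB. cnj (U i k) * U i m) * (\<Sum>i'<dB. cnj (U i' m') * U i' k)))"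
      by (simp only: sum_product) (simp only: sum_distrib_left mult.assoc)
    also have "\<dots> = (\<Sum>k<dB. if k = m then (if m = m' then of_real (lam m) else 0) else 0)"
      using m by (intro sum.cong refl) (auto simp: orth)
    also have "\<dots> = (if m = m' then of_real (lam m) else 0)" using m by simp
    finally show ?thesis .
  qed
  have lam: "lam m = (\<Sum>j<dC. (cmod (\<Psi> m j))\<^sup>2)" if "m < dB" for m
  proof -
    have "of_real (lam m) = (\<Sum>j<dC. complex_of_real ((cmod (\<Psi> m j))\<^sup>2))"
      using gram[OF that that] unfolding cnj_mult_self by simp
    thus ?thesis unfolding of_real_sum[symmetric] of_real_eq_iff .
  qed
  have "(\<Sum>m<dB. lam m) = (\<Sum>m<dB. \<Sum>j<dC. (cmod (\<Psi> m j))\<^sup>2)" by (simp add: lam)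
  also have "\<dots> = (\<Sum>j<dC. \<Sum>m<dB. (cmod (\<Psi> m j))\<^sup>2)" by (rule sum.swap)
  also have "\<dots> = (\<Sum>j<dC. \<Sum>i<dB. (cmod (\<Phi> i j))\<^sup>2)"
    using isometry_norm[of dB U, OF orth] by (simp add: exp)
  also have "\<dots> = (\<Sum>i<dB. \<Sum>j<dC. (cmod (\<Phi> i j))\<^sup>2)" by (rule sum.swap)
  finally have "(\<Sum>m<dB. lam m) = 1" using norm by simp
  moreover have "0 \<le> lam m" if "m < dB" for m by (simp add: lam that sum_nonneg)
  moreover have "ent dB dC \<phi> = - (\<Sum>m<dB. xlogx (lam m))"
    unfolding ent_def \<rho>_def[symmetric] by (rule vn_entropy_eq_sum[OF char])
  ultimately show ?thesis using that[of U \<Psi> lam] orth comp exp gram by (simp add: \<Phi>_def)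
qed

text \<open>\<open>K\<close> times its adjoint has the columns of \<open>U\<close> as eigenvectors,
  with eigenvalues \<open>lam m * (w m)\<^sup>2\<close> at most \<open>\<eta>\<close>. By
  \<open>PPT_sform_le\<close> the form is thus at most \<open>\<eta>\<close> times the trace of the
  partial trace of \<open>M\<close>, which is the trace of \<open>M\<close>.\<close>

lemma PPT_overlap_le_trace:
  fixes U \<Psi> :: "nat \<Rightarrow> nat \<Rightarrow> complex" and lam w :: "nat \<Rightarrow> real"
  assumes M: "psd (dB * dC) M" "PPT dB dC M"
    and comp: "\<And>i j. i < dB \<Longrightarrow> j < dB \<Longrightarrow> (\<Sum>k<dB. U i k * cnj (U j k)) = (if i = j then 1 else 0)"
    and gram: "\<And>m m'. m < dB \<Longrightarrow> m' < dB \<Longrightarrow>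
      (\<Sum>j<dC. cnj (\<Psi> m j) * \<Psi> m' j) = (if m = m' then of_real (lam m) else 0)"
    and le: "\<And>m. m < dB \<Longrightarrow> lam m * (w m)\<^sup>2 \<le> \<eta>"
  defines "K \<equiv> \<lambda>i j. \<Sum>m<dB. U i m * (of_real (w m) * \<Psi> m j)"
  shows "Re (sform (dB * dC) M (vectorize dC K) (vectorize dC K)) \<le> \<eta> * Re (mtrace M)"
proof -
  define R where "R k i = (\<Sum>l<dC. M $$ (pidx dC k l, pidx dC i l))" for k i
  define q where "q m = (\<Sum>k<dB. \<Sum>i<dB. cnj (U k m) * U i m * R k i)" for m
  \<comment> \<open>\<open>q m\<close> is the expectation of the partial trace of \<open>M\<close>
    in column \<open>m\<close> of \<open>U\<close>: a sum of forms of \<open>M\<close> at that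
    column tensored with the basis vectors of the second factor.\<close>
  have q: "0 \<le> Re (q m)" for m
  proof -
    have "q m = (\<Sum>k<dB. \<Sum>i<dB. \<Sum>l<dC. cnj (U k m) * M $$ (pidx dC k l, pidx dC i l) * U i m)"
      by (simp add: q_def R_def sum_distrib_left sum_distrib_right mult_ac)
    also have "\<dots> = (\<Sum>k<dB. \<Sum>l<dC. \<Sum>i<dB. cnj (U k m) * M $$ (pidx dC k l, pidx dC i l) * U i m)"
      by (intro sum.cong refl sum.swap)
    also have "\<dots> = (\<Sum>l<dC. \<Sum>k<dB. \<Sum>i<dB. cnj (U k m) * M $$ (pidx dC k l, pidx dC i l) * U i m)"
      by (rule sum.swap)
    also have "\<dots> = (\<Sum>l<dC. sform (dB * dC) M (vectorize dC (\<lambda>k l'. if l' = l then U k m else 0))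
        (vectorize dC (\<lambda>k l'. if l' = l then U k m else 0)))"
      by (intro sum.cong refl sform_vectorize_slices[symmetric]) auto
    finally show ?thesis unfolding Re_sum by (simp add: sum_nonneg psd_sform_nonneg[OF M(1)])
  qed
  have KK: "(\<Sum>j<dC. cnj (K k j) * K i j) = (\<Sum>m<dB. of_real (lam m * (w m)\<^sup>2) * (cnj (U k m) * U i m))" for k i
  proof -
    have "(\<Sum>j<dC. cnj (K k j) * K i j)
        = (\<Sum>j<dC. \<Sum>m<dB. \<Sum>m'<dB. of_real (w m * w m') * (cnj (U k m) * U i m') * (cnj (\<Psi> m j) * \<Psi> m' j))"
      unfolding K_def cnj_sum sum_product by (simp add: mult_ac)
    also have "\<dots> = (\<Sum>m<dB. \<Sum>j<dC. \<Sum>m'<dB. of_real (w m * w m') * (cnj (U k m) * U i m') * (cnj (\<Psi> m j) * \<Psi> m' j))"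
      by (rule sum.swap)
    also have "\<dots> = (\<Sum>m<dB. \<Sum>m'<dB. \<Sum>j<dC. of_real (w m * w m') * (cnj (U k m) * U i m') * (cnj (\<Psi> m j) * \<Psi> m' j))"
      by (intro sum.cong refl sum.swap)
    also have "\<dots> = (\<Sum>m<dB. \<Sum>m'<dB. if m = m' then of_real (lam m * (w m)\<^sup>2) * (cnj (U k m) * U i m) else 0)"
      by (intro sum.cong refl) (auto simp: gram power2_eq_square simp flip: sum_distrib_left)
    finally show ?thesis by simp
  qed
  have "Re (sform (dB * dC) M (vectorize dC K) (vectorize dC K))
      \<le> Re (\<Sum>k<dB. \<Sum>i<dB. (\<Sum>j<dC. cnj (K k j) * K i j) * R k i)"
    unfolding R_def by (rule PPT_sform_le[OF M(2)])
  also have "(\<Sum>k<dB. \<Sum>i<dB. (\<Sum>j<dC. cnj (K k j) * K i j) * R k i)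
      = (\<Sum>k<dB. \<Sum>i<dB. \<Sum>m<dB. of_real (lam m * (w m)\<^sup>2) * (cnj (U k m) * U i m * R k i))"
    by (simp only: KK sum_distrib_right mult.assoc)
  also have "\<dots> = (\<Sum>k<dB. \<Sum>m<dB. \<Sum>i<dB. of_real (lam m * (w m)\<^sup>2) * (cnj (U k m) * U i m * R k i))"
    by (intro sum.cong refl sum.swap)
  also have "\<dots> = (\<Sum>m<dB. \<Sum>k<dB. \<Sum>i<dB. of_real (lam m * (w m)\<^sup>2) * (cnj (U k m) * U i m * R k i))"
    by (rule sum.swap)
  also have "\<dots> = (\<Sum>m<dB. of_real (lam m * (w m)\<^sup>2) * q m)"
    by (simp only: q_def sum_distrib_left)
  also have "Re \<dots> = (\<Sum>m<dB. (lam m * (w m)\<^sup>2) * Re (q m))"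
    by (simp del: of_real_mult)
  also have "\<dots> \<le> (\<Sum>m<dB. \<eta> * Re (q m))"
    using le q by (intro sum_mono mult_right_mono) auto
  also have "\<dots> = \<eta> * Re (\<Sum>m<dB. q m)" by (simp add: sum_distrib_left)
  also have "(\<Sum>m<dB. q m) = mtrace M"
  proof -
    have "(\<Sum>m<dB. q m) = (\<Sum>k<dB. \<Sum>m<dB. \<Sum>i<dB. R k i * (U i m * cnj (U k m)))"
      unfolding q_def by (subst sum.swap) (simp add: mult_ac)
    also have "\<dots> = (\<Sum>k<dB. \<Sum>i<dB. \<Sum>m<dB. R k i * (U i m * cnj (U k m)))"
      by (intro sum.cong refl sum.swap)
    also have "\<dots> = (\<Sum>k<dB. \<Sum>i<dB. if i = k then R k i else 0)"
      by (intro sum.cong refl) (auto simp: comp simp flip: sum_distrib_left)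
    also have "\<dots> = (\<Sum>k<dB. R k k)" by simp
    finally have "(\<Sum>m<dB. q m) = (\<Sum>k<dB. R k k)" .
    moreover have "dim_row M = dB * dC" using M(2) by (auto simp: PPT_def)
    ultimately show ?thesis by (simp add: R_def mtrace_def sum_pidx)
  qed
  finally show ?thesis .
qed

text \<open>The scalar inequality at \<open>x = d * lam m\<close>, weighted by \<open>lam m\<close>
  and summed: the logarithms give \<open>log 2 d\<close> minus the entropy, and each of the
  \<open>d\<close> correction terms is at most \<open>2 / 3 / d\<close>.\<close>

lemma clip_defect_sum_le:
  fixes lam :: "nat \<Rightarrow> real"
  assumes d: "1 \<le> d" and T: "1 \<le> T"
    and lam: "\<And>m. m < d \<Longrightarrow> 0 \<le> lam m" "(\<Sum>m<d. lam m) = 1"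
  shows "T * (\<Sum>m<d. lam m * (1 - clip (2 powr T / (3 * T)) (real d * lam m))\<^sup>2)
      \<le> log 2 (real d) + (\<Sum>m<d. xlogx (lam m)) + 2 / 3"
proof -
  let ?u = "\<lambda>m. clip (2 powr T / (3 * T)) (real d * lam m)"
  have *: "T * (lam m * (1 - ?u m)\<^sup>2) \<le> lam m * log 2 (real d) + xlogx (lam m) + 2 / 3 / real d"
    if "m < d" for m
  proof (cases "lam m = 0")
    case True
    thus ?thesis using d by (simp add: xlogx_def)
  next
    case False
    hence pos: "lam m > 0" using lam(1)[OF that] by simp
    have "lam m * (T * (1 - ?u m)\<^sup>2) \<le> lam m * (log 2 (real d * lam m) + 2 / 3 / (real d * lam m))"
      using pos d T by (intro mult_left_mono clip_defect_le) auto
    also have "\<dots> = lam m * log 2 (real d) + xlogx (lam m) + 2 / 3 / real d"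
      using pos d by (simp add: xlogx_def log_mult field_simps)
    finally show ?thesis by (simp add: mult_ac)
  qed
  have "T * (\<Sum>m<d. lam m * (1 - ?u m)\<^sup>2) = (\<Sum>m<d. T * (lam m * (1 - ?u m)\<^sup>2))"
    by (rule sum_distrib_left)
  also have "\<dots> \<le> (\<Sum>m<d. lam m * log 2 (real d) + xlogx (lam m) + 2 / 3 / real d)"
    using * by (intro sum_mono) auto
  also have "\<dots> = log 2 (real d) + (\<Sum>m<d. xlogx (lam m)) + 2 / 3"
    using d by (simp add: sum.distrib lam(2) flip: sum_distrib_right)
  finally show ?thesis .
qed

text \<open>Here \<open>c\<close> stands for \<open>1 / sqrt \<gamma>\<close> and \<open>T\<close>
  for \<open>\<gamma> * (\<Delta> + 1)\<close>; the relation
  \<open>\<Delta> + 1 = c\<^sup>2 * T\<close> eliminates \<open>\<gamma>\<close>.\<close>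

lemma PPT_overlap_le:
  assumes dB: "1 \<le> dB"
    and \<phi>: "unit_vec_c (dB * dC) \<phi>"
    and M: "psd (dB * dC) M" "PPT dB dC M"
    and M_le: "\<And>x. Re (sform (dB * dC) M x x) \<le> (\<Sum>r<dB * dC. (cmod (x r))\<^sup>2)"
    and ent: "ent dB dC \<phi> \<ge> log 2 (real dB) - \<Delta>"
    and T: "1 \<le> T" and c: "0 < c" "c \<le> 1" "\<Delta> + 1 = c\<^sup>2 * T"
  shows "Re (mtrace (proj \<phi> * M)) \<le> c + 2 powr T / real dB * Re (mtrace M)"
proof -
  obtain U \<Psi> :: "nat \<Rightarrow> nat \<Rightarrow> complex" and lam :: "nat \<Rightarrow> real" where
    orth: "\<And>k l. k < dB \<Longrightarrow> l < dB \<Longrightarrow> (\<Sum>i<dB. cnj (U i k) * U i l) = (if k = l then 1 else 0)" and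
    comp: "\<And>i j. i < dB \<Longrightarrow> j < dB \<Longrightarrow> (\<Sum>k<dB. U i k * cnj (U j k)) = (if i = j then 1 else 0)" and
    exp: "\<And>i j. i < dB \<Longrightarrow> j < dC \<Longrightarrow> \<phi> $ pidx dC i j = (\<Sum>m<dB. U i m * \<Psi> m j)" and
    gram: "\<And>m m'. m < dB \<Longrightarrow> m' < dB \<Longrightarrow>
      (\<Sum>j<dC. cnj (\<Psi> m j) * \<Psi> m' j) = (if m = m' then of_real (lam m) else 0)" and
    lam: "\<And>m. m < dB \<Longrightarrow> 0 \<le> lam m" "(\<Sum>m<dB. lam m) = 1" and
    ent_eq: "ent dB dC \<phi> = - (\<Sum>m<dB. xlogx (lam m))"
    using schmidt_decomposition[OF \<phi>] by blast
  \<comment> \<open>The two choices satisfy \<open>\<theta> / t = 2 powr T\<close>: the loss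
    \<open>1 / t\<close> in the Cauchy-Schwarz inequality is absorbed by the lowered
    threshold.\<close>
  define \<theta> where "\<theta> = 2 powr T / (3 * T)"
  define t where "t = 1 / (3 * T)"
  have \<theta>: "\<theta> > 0" and t: "0 < t" "t < 1" using T by (auto simp: \<theta>_def t_def)
  define u where "u m = clip \<theta> (real dB * lam m)" for m
  \<comment> \<open>\<open>K\<close> is the clipped state and \<open>L\<close> the part removed from
    \<open>\<phi>\<close>.\<close>
  define K where "K i j = (\<Sum>m<dB. U i m * (of_real (u m) * \<Psi> m j))" for i j
  define L where "L i j = (\<Sum>m<dB. U i m * (of_real (1 - u m) * \<Psi> m j))" for i j
  let ?n = "dB * dC"
  let ?k = "vectorize dC K" and ?l = "vectorize dC L"
  have sum_KL: "\<phi> $ r = ?k r + ?l r" if r: "r < ?n" for r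
  proof -
    have dC: "0 < dC" using r by (cases dC) auto
    have "r div dC < dB" using r by (simp add: less_mult_imp_div_less)
    moreover have "r mod dC < dC" using dC by simp
    moreover have "pidx dC (r div dC) (r mod dC) = r" by (simp add: pidx_def)
    ultimately have "\<phi> $ r = (\<Sum>m<dB. U (r div dC) m * \<Psi> m (r mod dC))" using exp by metis
    thus ?thesis
      by (simp add: vectorize_def K_def L_def algebra_simps flip: sum.distrib)
  qed
  have carr: "\<phi> \<in> carrier_vec ?n" "M \<in> carrier_mat ?n ?n"
    using \<phi> M by (auto simp: unit_vec_c_def PPT_def)
  have "mtrace (proj \<phi> * M) = sform ?n M (\<lambda>r. ?k r + ?l r) (\<lambda>r. ?k r + ?l r)"
    unfolding mtrace_proj_mult[OF carr] by (intro sform_cong sum_KL)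
  hence split: "Re (mtrace (proj \<phi> * M)) \<le> Re (sform ?n M ?k ?k) / t + Re (sform ?n M ?l ?l) / (1 - t)"
    using psd_sform_add_le[OF M(1) t] by simp
  have "Re (sform ?n M ?k ?k) \<le> \<theta> / real dB * Re (mtrace M)"
    unfolding K_def
  proof (rule PPT_overlap_le_trace[OF M comp gram])
    fix m
    have "real dB * lam m * (u m)\<^sup>2 \<le> \<theta>" unfolding u_def using \<theta> by (intro clip_square_le) simp
    thus "lam m * (u m)\<^sup>2 \<le> \<theta> / real dB" using dB by (simp add: field_simps)
  qed
  hence "Re (sform ?n M ?k ?k) / t \<le> \<theta> / real dB * Re (mtrace M) / t"
    using t by (intro divide_right_mono) auto
  also have "\<dots> = 2 powr T / real dB * Re (mtrace M)" using T by (simp add: \<theta>_def t_def)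
  finally have 1: "Re (sform ?n M ?k ?k) / t \<le> 2 powr T / real dB * Re (mtrace M)" .
  have "(\<Sum>r<?n. (cmod (?l r))\<^sup>2) = (\<Sum>i<dB. \<Sum>j<dC. (cmod (L i j))\<^sup>2)"
    unfolding sum_pidx by simp
  also have "\<dots> = (\<Sum>j<dC. \<Sum>i<dB. (cmod (L i j))\<^sup>2)" by (rule sum.swap)
  also have "\<dots> = (\<Sum>j<dC. \<Sum>m<dB. (cmod (of_real (1 - u m) * \<Psi> m j))\<^sup>2)"
    unfolding L_def by (intro sum.cong refl isometry_norm[of dB U] orth) auto
  also have "\<dots> = (\<Sum>m<dB. \<Sum>j<dC. (cmod (of_real (1 - u m) * \<Psi> m j))\<^sup>2)" by (rule sum.swap)
  also have "\<dots> = (\<Sum>m<dB. lam m * (1 - u m)\<^sup>2)"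
  proof (intro sum.cong refl)
    fix m assume "m \<in> {..<dB}"
    hence "of_real (lam m) = (\<Sum>j<dC. complex_of_real ((cmod (\<Psi> m j))\<^sup>2))"
      using gram[of m m] unfolding cnj_mult_self by simp
    hence "lam m = (\<Sum>j<dC. (cmod (\<Psi> m j))\<^sup>2)" unfolding of_real_sum[symmetric] of_real_eq_iff .
    thus "(\<Sum>j<dC. (cmod (of_real (1 - u m) * \<Psi> m j))\<^sup>2) = lam m * (1 - u m)\<^sup>2"
      by (simp add: norm_mult power_mult_distrib sum_distrib_left mult.commute del: of_real_diff)
  qed
  finally have L_norm: "(\<Sum>r<?n. (cmod (?l r))\<^sup>2) = (\<Sum>m<dB. lam m * (1 - u m)\<^sup>2)" .
  have "T * Re (sform ?n M ?l ?l) \<le> T * (\<Sum>m<dB. lam m * (1 - u m)\<^sup>2)"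
    using M_le[of ?l] T by (intro mult_left_mono) (auto simp: L_norm)
  also have "\<dots> \<le> log 2 (real dB) + (\<Sum>m<dB. xlogx (lam m)) + 2 / 3"
    unfolding u_def \<theta>_def by (rule clip_defect_sum_le[OF dB T lam])
  \<comment> \<open>The entropy deficit is at most \<open>\<Delta>\<close>, and
    \<open>\<Delta> + 2 / 3\<close> is \<open>c\<^sup>2 * T - 1 / 3\<close>. The remaining 1/3 pays
    for the factor \<open>1 - t\<close>, using \<open>c \<le> 1\<close>.\<close>
  also have "\<dots> \<le> c\<^sup>2 * T - 1 / 3" using ent ent_eq c(3) by simp
  also have "\<dots> \<le> c * T - c / 3"
  proof -
    have "c\<^sup>2 * T \<le> c * T" using c T by (intro mult_right_mono) (auto simp: power2_eq_square mult_le_one)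
    thus ?thesis using c by simp
  qed
  also have "\<dots> = T * (c * (1 - t))" using T by (simp add: t_def field_simps)
  finally have "Re (sform ?n M ?l ?l) \<le> c * (1 - t)" using T by simp
  hence 2: "Re (sform ?n M ?l ?l) / (1 - t) \<le> c" using t by (simp add: field_simps)
  show ?thesis using split 1 2 by linarith
qed

section \<open>Summation over the POVM\<close>

theorem mainTheorem6:
  fixes dB dC N :: nat and \<phi> :: "nat \<Rightarrow> complex vec" and M :: "nat \<Rightarrow> complex mat"
    and \<Delta> :: "nat \<Rightarrow> real" and \<epsilon> \<gamma> :: real
  assumes "1 \<le> dB" and "dB \<le> dC" and "1 \<le> N"
    and "\<forall>i<N. unit_vec_c (dB * dC) (\<phi> i)"
    and "\<forall>i<N. \<Delta> i \<ge> 0 \<and> ent dB dC (\<phi> i) \<ge> log 2 (real dB) - \<Delta> i"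
    and "POVM (dB * dC) N M"
    and "\<forall>i<N. PPT dB dC (M i)"
    and "\<epsilon> < 1"
    and "\<forall>i<N. Re (mtrace (proj (\<phi> i) * M i)) \<ge> 1 - \<epsilon>"
    and "\<gamma> > 1 / (1 - \<epsilon>)\<^sup>2"
  shows "real N \<le> inverse (1 - \<epsilon> - sqrt (1 / \<gamma>))
             * inverse ((1 / real N) * (\<Sum>i<N. 2 powr (- \<gamma> * (\<Delta> i + 1)))) * real dC
       \<and> inverse (1 - \<epsilon> - sqrt (1 / \<gamma>))
             * inverse ((1 / real N) * (\<Sum>i<N. 2 powr (- \<gamma> * (\<Delta> i + 1)))) * real dC
         \<le> inverse (1 - \<epsilon> - sqrt (1 / \<gamma>))
             * 2 powr ((\<Sum>i<N. \<gamma> * (\<Delta> i + 1)) / real N) * real dC"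
proof -
  let ?n = "dB * dC"
  define c where "c = sqrt (1 / \<gamma>)"
  define T where "T i = \<gamma> * (\<Delta> i + 1)" for i
  define S where "S = (\<Sum>i<N. 2 powr (- T i))"
  have M: "psd ?n (M i)" "PPT dB dC (M i)" "M i \<in> carrier_mat ?n ?n" if "i < N" for i
    using assms(6,7) that by (auto simp: POVM_def PPT_def)
  have le: "Re (sform ?n (M i) x x) \<le> (\<Sum>r<?n. (cmod (x r))\<^sup>2)" if "i < N" for i x
    using POVM_sform_le[OF assms(6) that] .
  \<comment> \<open>The success probability is at most 1, and \<open>N\<close> is positive. Hence
    \<open>\<gamma>\<close> exceeds 1, which yields \<open>c \<le> 1\<close> and
    \<open>1 \<le> T i\<close>.\<close>
  have "0 \<le> \<epsilon>"
  proof -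
    have \<phi>0: "\<phi> 0 \<in> carrier_vec ?n" "(\<Sum>r<?n. (cmod (\<phi> 0 $ r))\<^sup>2) = 1"
      using assms(3,4) by (auto simp: unit_vec_c_def)
    have "1 - \<epsilon> \<le> Re (mtrace (proj (\<phi> 0) * M 0))" using assms(3,9) by simp
    also have "\<dots> \<le> 1"
      using mtrace_proj_mult[OF \<phi>0(1) M(3)] le[of 0 "\<lambda>r. \<phi> 0 $ r"] \<phi>0(2) assms(3) by simp
    finally show ?thesis by simp
  qed
  hence "(1 - \<epsilon>)\<^sup>2 \<le> 1" using assms(8) by (simp add: power_le_one)
  hence "1 \<le> 1 / (1 - \<epsilon>)\<^sup>2" using assms(8) by simp
  hence \<gamma>: "1 < \<gamma>" using assms(10) by simp
  have c: "0 < c" "c \<le> 1" "c\<^sup>2 = 1 / \<gamma>" using \<gamma> by (auto simp: c_def)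
  have "1 / \<gamma> < (1 - \<epsilon>)\<^sup>2" using assms(8,10) \<gamma> by (simp add: field_simps)
  hence gap: "0 < 1 - \<epsilon> - c" using power2_less_imp_less[of c "1 - \<epsilon>"] assms(8) c(3) by simp
  have T: "1 \<le> T i" if "i < N" for i
  proof -
    have "0 \<le> \<Delta> i" using assms(5) that by simp
    hence "1 * 1 \<le> \<gamma> * (\<Delta> i + 1)" using \<gamma> by (intro mult_mono) auto
    thus ?thesis by (simp add: T_def)
  qed
  \<comment> \<open>The overlap bound, solved for the trace of the single element
    \<open>M i\<close>.\<close>
  have "(1 - \<epsilon> - c) * real dB * 2 powr (- T i) \<le> Re (mtrace (M i))" if i: "i < N" for i
  proof -
    have "1 - \<epsilon> \<le> Re (mtrace (proj (\<phi> i) * M i))" using assms(9) i by simp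
    also have "\<dots> \<le> c + 2 powr T i / real dB * Re (mtrace (M i))"
      using assms(4,5) i c \<gamma>
      by (intro PPT_overlap_le[OF assms(1) _ M(1,2) le, where \<Delta> = "\<Delta> i"] T) (auto simp: T_def)
    finally have "1 - \<epsilon> - c \<le> 2 powr T i / real dB * Re (mtrace (M i))" by simp
    thus ?thesis using assms(1) by (simp add: powr_minus field_simps)
  qed
  hence "(\<Sum>i<N. (1 - \<epsilon> - c) * real dB * 2 powr (- T i)) \<le> (\<Sum>i<N. Re (mtrace (M i)))"
    by (intro sum_mono) auto
  also have "\<dots> = Re (\<Sum>i<N. \<Sum>r<?n. M i $$ (r, r))"
    using M(3) by (auto simp: mtrace_def intro!: sum.cong)
  also have "(\<Sum>i<N. \<Sum>r<?n. M i $$ (r, r)) = (\<Sum>r<?n. \<Sum>i<N. M i $$ (r, r))" by (rule sum.swap)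
  \<comment> \<open>The POVM elements sum to the identity on a space of dimension
    \<open>dB * dC\<close>; the factor \<open>dB\<close> then cancels.\<close>
  also have "\<dots> = of_nat ?n" using assms(6) by (simp add: POVM_def)
  finally have "real dB * ((1 - \<epsilon> - c) * S) \<le> real dB * real dC"
    by (simp add: S_def mult_ac flip: sum_distrib_left)
  hence main: "(1 - \<epsilon> - c) * S \<le> real dC" using assms(1) by simp
  have S: "0 < S" unfolding S_def using assms(3) by (intro sum_pos) (auto simp: lessThan_empty_iff)
  have first: "real N \<le> inverse (1 - \<epsilon> - c) * inverse ((1 / real N) * S) * real dC"
  proof -
    have "1 \<le> real dC / ((1 - \<epsilon> - c) * S)" using main gap S by (simp add: le_divide_eq)
    hence "real N * 1 \<le> real N * (real dC / ((1 - \<epsilon> - c) * S))" by (intro mult_left_mono) auto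
    also have "\<dots> = inverse (1 - \<epsilon> - c) * inverse ((1 / real N) * S) * real dC"
      by (simp add: divide_simps)
    finally show ?thesis by simp
  qed
  have "2 powr (- ((\<Sum>i<N. T i) / real N)) \<le> (1 / real N) * S"
    unfolding S_def by (rule jensen_two_powr[OF assms(3)])
  hence "inverse ((1 / real N) * S) \<le> inverse (2 powr (- ((\<Sum>i<N. T i) / real N)))"
    by (rule le_imp_inverse_le) simp
  also have "\<dots> = 2 powr ((\<Sum>i<N. T i) / real N)" by (simp add: powr_minus)
  finally have "inverse (1 - \<epsilon> - c) * inverse ((1 / real N) * S) * real dC
      \<le> inverse (1 - \<epsilon> - c) * 2 powr ((\<Sum>i<N. T i) / real N) * real dC"
    using gap by (intro mult_right_mono mult_left_mono) auto
  with first show ?thesis unfolding S_def c_def T_def by simp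
qed

end
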